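(* Let $p$ be a prime, let $m \ge 2$ be an integer, and let $\delta>0$, $\nu>0$, $\epsilon>0$. Then there exists $C_{\mathrm{cor}}(\delta,\nu,\epsilon,p,m)>0$ such that the following holds. If $s$ is a positive integer and $\mathcal{A}_1,\dots,\mathcal{A}_s$ are non-empty subsets of $\{0,1\}^n$ each with density at least $\delta$ inside $\{0,1\}^n$, then there exists a subset $R \subset [s]$ with $|R| \ge s/(n+1)^{C_{\mathrm{cor}}(\delta,\nu,\epsilon,p,m)}$ such that for at least $(1-\epsilon)|R|^m$ of the $m$-tuples $(i_1,\dots,i_m) \in R^m$ we have \[\mathrm{cor}_{\mathcal{A}_{i_1},\dots,\mathcal{A}_{i_m}}\phi \ge -\nu\] for every mod-$p$ form $\phi$.
   Context: A mod-$p$ form is a linear form $\phi:\mathbb{F}_p^n\to\mathbb{F}_p$, $\phi(x)=a_1x_1+\dots+a_nx_n$; it is evaluated on $\{0,1\}^n$ by identifying $\{0,1\}$ with the elements $0,1$ of $\mathbb{F}_p$. The density of $\mathcal{A}\subset\{0,1\}^n$ is $|\mathcal{A}|/2^n$. For random variables $X_1,\dots,X_m$ taking values in a finite set $D$, the correlation is $\mathrm{cor}(X_1,\dots,X_m)=\big(\sum_{d\in D}\mathbb{P}[X_1=d]\cdots\mathbb{P}[X_m=d]\big)-1/|D|^{m-1}$. For a function $F$ on $\{0,1\}^n$ and non-empty $\mathcal{A}_1,\dots,\mathcal{A}_m\subset\{0,1\}^n$, $\mathrm{cor}_{\mathcal{A}_1,\dots,\mathcal{A}_m}(F)$ denotes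 $\mathrm{cor}(X_1,\dots,X_m)$ where $X_i$ is distributed as $F(x)$ for $x$ uniform in $\mathcal{A}_i$ (for a mod-$p$ form, $D=\mathbb{F}_p$). *)

theory Defs
  imports "HOL-Probability.Probability" "HOL-Number_Theory.Residues"
begin

abbreviation F_ring :: "nat \<Rightarrow> int ring" where
  "F_ring p \<equiv> residue_ring (int p)"

definition F_space :: "nat \<Rightarrow> nat \<Rightarrow> (nat \<Rightarrow> int) set" where
  "F_space p n = {1..n} \<rightarrow>\<^sub>E carrier (F_ring p)"

text \<open>The carrier of \<^term>\<open>F_ring p\<close> is the set of integers \<open>0, \<dots>, p - 1\<close>, with zero \<open>0\<close> and
  one \<open>1\<close>; so with integer entries the cube is literally a subset of \<^term>\<open>F_space p n\<close>.\<close>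

definition cube :: "nat \<Rightarrow> (nat \<Rightarrow> int) set" where
  "cube n = {1..n} \<rightarrow>\<^sub>E {0, 1}"

lemma cube_subset_F_space: "prime p \<Longrightarrow> cube n \<subseteq> F_space p n"
  unfolding cube_def F_space_def residue_ring_def
  by (intro PiE_mono) (use prime_gt_1_nat[of p] in auto)

definition cube_density :: "nat \<Rightarrow> (nat \<Rightarrow> int) set \<Rightarrow> real" where
  "cube_density n A = real (card A) / 2 ^ n"

text \<open>Only the values of \<open>\<phi>\<close> on \<^term>\<open>F_space p n\<close> matter.\<close>

definition mod_form :: "nat \<Rightarrow> nat \<Rightarrow> ((nat \<Rightarrow> int) \<Rightarrow> int) \<Rightarrow> bool" where
  "mod_form p n \<phi> \<longleftrightarrow>
    (\<exists>a \<in> {1..n} \<rightarrow> carrier (F_ring p). \<forall>x \<in> F_space p n.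
      \<phi> x = (\<Oplus>\<^bsub>F_ring p\<^esub>i\<in>{1..n}. a i \<otimes>\<^bsub>F_ring p\<^esub> x i))"

text \<open>The correlation depends only on the laws of the random variables \<open>X 1, \<dots>, X m\<close>, so these
  are given as probability mass functions.\<close>

definition cor :: "'d set \<Rightarrow> nat \<Rightarrow> (nat \<Rightarrow> 'd pmf) \<Rightarrow> real" where
  "cor D m X = (\<Sum>d\<in>D. \<Prod>j\<in>{1..m}. pmf (X j) d) - 1 / real (card D) ^ (m - 1)"

definition cor_on :: "'d set \<Rightarrow> nat \<Rightarrow> (nat \<Rightarrow> (nat \<Rightarrow> int) set) \<Rightarrow> ((nat \<Rightarrow> int) \<Rightarrow> 'd) \<Rightarrow> real" where
  "cor_on D m B F = cor D m (\<lambda>j. map_pmf F (pmf_of_set (B j)))"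

end

theory Submission
  imports Defs "HOL-Library.Real_Mod"
begin

text \<open>
  Two observations drive the proof. First, by the Halasz-Montgomery inequality for almost
  orthogonal characters, the forms that are not nearly uniformly distributed on a fixed dense set
  lie in boundedly many Hamming balls of bounded radius, so there are only polynomially many.
  Second, label the points of the cube by the values of boundedly many forms, and restrict to
  indices for which the laws of the label nearly agree. If the correlation of a tuple along
  \<open>\<phi>\<close> is too negative, then the law of \<open>\<phi>\<close> on some member of
  the tuple is not the one predicted from its label, so adding \<open>\<phi>\<close> to the label
  increases the \<open>L\<^sup>2\<close> energy of that member; and \<open>\<phi>\<close> must
  also be biased on a different member, since otherwise all but one of the laws are nearly uniform
  and the correlation is near zero. Hence if many tuples are bad, some index occurs as that biased
  member together with a positive proportion of the others, and as it has only polynomially many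
  biased forms, a single form \<open>\<phi>\<close> increases the energy of a polynomial
  proportion of the indices. The energy of a set of density \<open>\<delta>\<close> is at most
  \<open>1 / \<delta>\<close>, so this stops after boundedly many steps.
\<close>

section \<open>Correlation of nearly equal laws\<close>

lemma cor_diff_le:
  assumes "\<And>j d. j \<in> {1..m} \<Longrightarrow> d \<in> D \<Longrightarrow> \<bar>pmf (X j) d - pmf (Y j) d\<bar> \<le> \<eta>"
  shows "\<bar>cor D m X - cor D m Y\<bar> \<le> real (card D) * real m * \<eta>"
proof -
  have prod_diff: "\<bar>(\<Prod>j\<in>{1..m}. pmf (X j) d) - (\<Prod>j\<in>{1..m}. pmf (Y j) d)\<bar> \<le> real m * \<eta>"
    if "d \<in> D" for d
  proof -
    have "norm ((\<Prod>j\<in>{1..m}. pmf (X j) d) - (\<Prod>j\<in>{1..m}. pmf (Y j) d))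
        \<le> (\<Sum>j\<in>{1..m}. norm (pmf (X j) d - pmf (Y j) d))"
      by (intro norm_prod_diff) (simp_all add: pmf_le_1)
    also have "\<dots> \<le> (\<Sum>j\<in>{1..m}. \<eta>)"
      using assms that by (intro sum_mono) auto
    finally show ?thesis by simp
  qed
  have "cor D m X - cor D m Y
      = (\<Sum>d\<in>D. (\<Prod>j\<in>{1..m}. pmf (X j) d) - (\<Prod>j\<in>{1..m}. pmf (Y j) d))"
    by (simp add: cor_def sum_subtractf)
  also have "\<bar>\<dots>\<bar> \<le> (\<Sum>d\<in>D. real m * \<eta>)"
    using prod_diff by (intro order_trans[OF sum_abs] sum_mono)
  finally show ?thesis by simp
qed

lemma convex_on_power_nonneg: "convex_on {0::real..} (\<lambda>x. x ^ n)"
  by (cases "even n") (auto intro: convex_power_odd convex_on_subset[OF convex_power_even])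

lemma cor_const_nonneg:
  assumes "finite D" "set_pmf P \<subseteq> D"
  shows "0 \<le> cor D m (\<lambda>_. P)"
proof -
  let ?k = "real (card D)"
  have "D \<noteq> {}" using assms(2) set_pmf_not_empty[of P] by auto
  then have k: "?k \<ge> 1" using assms(1) by (simp add: Suc_le_eq card_gt_0_iff)
  have "(\<Sum>d\<in>D. (1 / ?k) *\<^sub>R pmf P d) ^ m \<le> (\<Sum>d\<in>D. 1 / ?k * pmf P d ^ m)"
    using assms \<open>D \<noteq> {}\<close> k by (intro convex_on_sum[OF _ _ convex_on_power_nonneg]) auto
  then have "1 / ?k ^ m \<le> (\<Sum>d\<in>D. pmf P d ^ m) / ?k"
    using assms by (simp add: sum_pmf_eq_1 power_one_over flip: sum_divide_distrib)
  then have "?k / ?k ^ m \<le> (\<Sum>d\<in>D. pmf P d ^ m)"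
    using k by (simp add: field_simps)
  moreover have "1 / ?k ^ (m - 1) \<le> ?k / ?k ^ m"
    using k by (cases m) auto
  ultimately show ?thesis by (simp add: cor_def)
qed

lemma cor_all_but_one_uniform_eq_0:
  assumes "finite D" "i \<in> {1..m}" "set_pmf (X i) \<subseteq> D"
    and "\<And>j. j \<in> {1..m} - {i} \<Longrightarrow> X j = pmf_of_set D"
  shows "cor D m X = 0"
proof -
  have "D \<noteq> {}" using assms(3) set_pmf_not_empty[of "X i"] by auto
  have "(\<Prod>j\<in>{1..m}. pmf (X j) d) = pmf (X i) d * (1 / real (card D)) ^ (m - 1)" if "d \<in> D" for d
  proof -
    have "(\<Prod>j\<in>{1..m}. pmf (X j) d) = pmf (X i) d * (\<Prod>j\<in>{1..m} - {i}. pmf (X j) d)"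
      using assms(2) by (intro prod.remove) auto
    also have "(\<Prod>j\<in>{1..m} - {i}. pmf (X j) d) = (\<Prod>j\<in>{1..m} - {i}. 1 / real (card D))"
      using assms \<open>D \<noteq> {}\<close> that by (intro prod.cong) auto
    finally show ?thesis using assms(2) by simp
  qed
  then show ?thesis
    using assms(1,3)
    by (simp add: cor_def sum_pmf_eq_1 power_one_over flip: sum_divide_distrib)
qed

lemma cor_ge_if_close:
  assumes "finite D" "set_pmf P \<subseteq> D"
    and "\<And>j d. j \<in> {1..m} \<Longrightarrow> d \<in> D \<Longrightarrow> \<bar>pmf (X j) d - pmf P d\<bar> \<le> \<eta>"
  shows "- (real (card D) * real m * \<eta>) \<le> cor D m X"
  using cor_diff_le[of m D X "\<lambda>_. P", OF assms(3)] cor_const_nonneg[OF assms(1,2), of m]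
  by linarith

lemma cor_ge_if_all_but_one_near_uniform:
  assumes "finite D" "i \<in> {1..m}" "set_pmf (X i) \<subseteq> D" "0 \<le> \<eta>"
    and "\<And>j d. j \<in> {1..m} - {i} \<Longrightarrow> d \<in> D \<Longrightarrow> \<bar>pmf (X j) d - 1 / real (card D)\<bar> \<le> \<eta>"
  shows "- (real (card D) * real m * \<eta>) \<le> cor D m X"
proof -
  let ?Y = "\<lambda>j. if j = i then X i else pmf_of_set D"
  have "cor D m ?Y = 0"
    using assms(1-3) by (intro cor_all_but_one_uniform_eq_0[where i = i]) auto
  moreover have "pmf (pmf_of_set D) d = 1 / real (card D)" if "d \<in> D" for d
    using that assms(1) by (subst pmf_of_set) auto
  then have "\<bar>cor D m X - cor D m ?Y\<bar> \<le> real (card D) * real m * \<eta>"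
    using assms by (intro cor_diff_le) auto
  ultimately show ?thesis by linarith
qed

section \<open>Dominated laws and their energy\<close>

definition dominated :: "real \<Rightarrow> 'a pmf \<Rightarrow> 'a pmf \<Rightarrow> bool" where
  "dominated K P Q \<longleftrightarrow> (\<forall>x. pmf Q x \<le> K * pmf P x)"

definition rel_density :: "'a pmf \<Rightarrow> 'a pmf \<Rightarrow> 'a \<Rightarrow> real" where
  "rel_density P Q x = pmf Q x / pmf P x"

definition energy :: "'a pmf \<Rightarrow> 'a pmf \<Rightarrow> real" where
  "energy P Q = measure_pmf.expectation P (\<lambda>x. (rel_density P Q x)\<^sup>2)"

text \<open>The probability that \<open>h = d\<close> under \<open>Q\<close>, as one would predict it from the law of \<open>g\<close> alone if
  \<open>P\<close> and \<open>Q\<close> had the same conditional laws given \<open>g\<close>.\<close>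

definition predicted_prob :: "'a pmf \<Rightarrow> 'a pmf \<Rightarrow> ('a \<Rightarrow> 'b) \<Rightarrow> ('a \<Rightarrow> 'c) \<Rightarrow> 'c \<Rightarrow> real" where
  "predicted_prob P Q g h d = measure_pmf.expectation P
     (\<lambda>x. rel_density (map_pmf g P) (map_pmf g Q) (g x) * of_bool (h x = d))"

lemma dominated_set_pmf_subset:
  assumes "dominated K P Q" shows "set_pmf Q \<subseteq> set_pmf P"
proof
  fix x assume "x \<in> set_pmf Q"
  then have "0 < K * pmf P x"
    using assms by (metis dominated_def pmf_positive less_le_trans)
  then show "x \<in> set_pmf P" by (auto simp: set_pmf_iff)
qed

lemma dominated_nonneg:
  assumes "dominated K P Q" shows "0 \<le> K"
proof -
  obtain x where "x \<in> set_pmf Q" using set_pmf_not_empty by fast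
  then have "0 < K * pmf P x"
    using assms by (metis dominated_def pmf_positive less_le_trans)
  then show ?thesis
    using pmf_nonneg[of P x] by (simp add: zero_less_mult_iff)
qed

lemma rel_density_nonneg [simp]: "0 \<le> rel_density P Q x"
  by (simp add: rel_density_def)

lemma rel_density_le:
  assumes "dominated K P Q" shows "rel_density P Q x \<le> K"
proof (cases "pmf P x = 0")
  case True
  then show ?thesis using dominated_nonneg[OF assms] by (simp add: rel_density_def)
next
  case False
  then have "0 < pmf P x" by (simp add: less_le)
  then show ?thesis using assms by (simp add: dominated_def rel_density_def divide_le_eq)
qed

lemma expectation_rel_density:
  fixes f :: "'a \<Rightarrow> real"
  assumes "set_pmf Q \<subseteq> set_pmf P"
  shows "measure_pmf.expectation P (\<lambda>x. rel_density P Q x * f x) = measure_pmf.expectation Q f"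
proof -
  have expectation_eq: "measure_pmf.expectation R u = (\<integral>x. pmf R x * u x \<partial>count_space UNIV)"
    for R :: "'a pmf" and u :: "'a \<Rightarrow> real"
    by (simp add: measure_pmf_eq_density integral_density)
  have "pmf P x * (rel_density P Q x * f x) = pmf Q x * f x" for x
    using assms by (cases "x \<in> set_pmf P") (auto simp: rel_density_def set_pmf_iff)
  then show ?thesis by (simp only: expectation_eq)
qed

lemma integrable_pmf_bounded:
  fixes f :: "'a \<Rightarrow> 'b::{banach, second_countable_topology}"
  assumes "\<And>x. norm (f x) \<le> B"
  shows "integrable (measure_pmf P) f"
  using assms by (intro measure_pmf.integrable_const_bound[where B = B]) auto

lemma norm_expectation_le:
  fixes f :: "'a \<Rightarrow> 'b::{banach, second_countable_topology}"
  assumes "\<And>x. norm (f x) \<le> B"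
  shows "norm (measure_pmf.expectation P f) \<le> B"
  using assms
  by (intro order_trans[OF integral_norm_bound] measure_pmf.integral_le_const
      integrable_pmf_bounded[where B = B]) auto

lemma abs_rel_density_diff_le:
  assumes "dominated K P Q" "dominated K P' Q'"
  shows "\<bar>rel_density P Q x - rel_density P' Q' y\<bar> \<le> K"
  using rel_density_le[OF assms(1), of x] rel_density_le[OF assms(2), of y]
    rel_density_nonneg[of P Q x] rel_density_nonneg[of P' Q' y] by linarith

lemma integrable_rel_density_of_bool:
  assumes "dominated K P Q"
  shows "integrable (measure_pmf R) (\<lambda>x. rel_density P Q (f x) * of_bool (b x))"
  using rel_density_le[OF assms] dominated_nonneg[OF assms]
  by (intro integrable_pmf_bounded[where B = K]) auto

lemma expectation_le_if_dominated:
  fixes f :: "'a \<Rightarrow> real"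
  assumes "dominated K P Q" "\<And>x. 0 \<le> f x" "\<And>x. f x \<le> B"
  shows "measure_pmf.expectation Q f \<le> K * measure_pmf.expectation P f"
proof -
  have density_le: "rel_density P Q x * f x \<le> K * f x" for x
    using assms by (intro mult_right_mono rel_density_le)
  have const_le: "K * f x \<le> K * B" for x
    using assms dominated_nonneg by (intro mult_left_mono) auto
  have "measure_pmf.expectation Q f = measure_pmf.expectation P (\<lambda>x. rel_density P Q x * f x)"
    by (simp add: expectation_rel_density dominated_set_pmf_subset[OF assms(1)])
  also have "\<dots> \<le> measure_pmf.expectation P (\<lambda>x. K * f x)"
    using assms dominated_nonneg[OF assms(1)] density_le const_le
      order_trans[OF density_le const_le]
    by (intro integral_mono integrable_pmf_bounded[where B = "K * B"]) auto
  finally show ?thesis by simp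
qed

lemma pmf_map_eq_expectation:
  "pmf (map_pmf f P) y = measure_pmf.expectation P (\<lambda>x. of_bool (f x = y))"
proof -
  have "(\<lambda>x. of_bool (f x = y)) = (indicator (f -` {y}) :: _ \<Rightarrow> real)"
    by (auto simp: indicator_def)
  then show ?thesis by (simp add: pmf_map)
qed

lemma dominated_map_pmf:
  assumes "dominated K P Q" shows "dominated K (map_pmf f P) (map_pmf f Q)"
  unfolding dominated_def pmf_map_eq_expectation
  using assms by (intro allI expectation_le_if_dominated[where B = 1]) auto

lemma dominated_pmf_of_set:
  assumes "finite \<Omega>" "A \<subseteq> \<Omega>" "A \<noteq> {}" "\<delta> > 0" "\<delta> * real (card \<Omega>) \<le> real (card A)"
  shows "dominated (1 / \<delta>) (pmf_of_set \<Omega>) (pmf_of_set A)"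
proof -
  have "finite A" "\<Omega> \<noteq> {}" using assms(1-3) finite_subset by auto
  then have "0 < card A" "0 < card \<Omega>"
    using assms(1,3) by (simp_all add: card_gt_0_iff)
  then show ?thesis
    using assms \<open>finite A\<close> \<open>\<Omega> \<noteq> {}\<close> by (auto simp: dominated_def indicator_def field_simps)
qed

lemma energy_nonneg: "0 \<le> energy P Q"
  by (simp add: energy_def)

lemma energy_le:
  assumes "dominated K P Q" shows "energy P Q \<le> K"
proof -
  have "energy P Q = measure_pmf.expectation Q (rel_density P Q)"
    using expectation_rel_density[OF dominated_set_pmf_subset[OF assms], of "rel_density P Q"]
    by (simp add: energy_def power2_eq_square)
  also have "\<dots> \<le> K"
    using rel_density_le[OF assms]
    by (intro measure_pmf.integral_le_const integrable_pmf_bounded[where B = K]) auto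
  finally show ?thesis .
qed

lemma power2_expectation_le:
  fixes f :: "'a \<Rightarrow> real"
  assumes "\<And>x. \<bar>f x\<bar> \<le> B"
  shows "(measure_pmf.expectation P f)\<^sup>2 \<le> measure_pmf.expectation P (\<lambda>x. (f x)\<^sup>2)"
proof -
  have "(f x)\<^sup>2 \<le> B\<^sup>2" for x
    using power_mono[OF assms abs_ge_zero, of x 2] by simp
  then have "integrable P f" "integrable P (\<lambda>x. (f x)\<^sup>2)"
    using assms by (auto intro: integrable_pmf_bounded[where B = B]
        integrable_pmf_bounded[where B = "B\<^sup>2"])
  then show ?thesis
    using measure_pmf.variance_positive[of P f] by (simp add: measure_pmf.variance_eq)
qed

lemma expectation_power2_rel_density_diff:
  assumes dom: "dominated K P Q"
  shows "measure_pmf.expectation P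
      (\<lambda>x. (rel_density P Q x - rel_density (map_pmf g P) (map_pmf g Q) (g x))\<^sup>2)
    = energy P Q - energy (map_pmf g P) (map_pmf g Q)"
proof -
  define r where "r = rel_density P Q"
  define \<rho> where "\<rho> = rel_density (map_pmf g P) (map_pmf g Q)"
  note support = dominated_set_pmf_subset[OF dom]
  have r_bounds: "0 \<le> r x" "r x \<le> K" for x
    using rel_density_le[OF dom] by (simp_all add: r_def)
  have \<rho>_bounds: "0 \<le> \<rho> y" "\<rho> y \<le> K" for y
    using rel_density_le[OF dominated_map_pmf[OF dom]] by (simp_all add: \<rho>_def)
  have integrable_products: "integrable P (\<lambda>x. r x * r x)" "integrable P (\<lambda>x. r x * \<rho> (g x))"
      "integrable P (\<lambda>x. \<rho> (g x) * \<rho> (g x))"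
    using r_bounds \<rho>_bounds order_trans[OF r_bounds]
    by (auto intro!: integrable_pmf_bounded[where B = "K * K"] simp: abs_mult mult_mono)
  have "measure_pmf.expectation (map_pmf g P) (\<lambda>y. \<rho> y * \<rho> y)
      = measure_pmf.expectation (map_pmf g Q) \<rho>"
    unfolding \<rho>_def using support by (intro expectation_rel_density) auto
  also have "\<dots> = measure_pmf.expectation P (\<lambda>x. r x * \<rho> (g x))"
    by (simp add: r_def expectation_rel_density[OF support])
  finally have cross_term: "measure_pmf.expectation P (\<lambda>x. r x * \<rho> (g x))
      = energy (map_pmf g P) (map_pmf g Q)"
    by (simp add: energy_def \<rho>_def power2_eq_square)
  have "measure_pmf.expectation P (\<lambda>x. (r x - \<rho> (g x))\<^sup>2)
      = measure_pmf.expectation P (\<lambda>x. r x * r x - 2 * (r x * \<rho> (g x)) + \<rho> (g x) * \<rho> (g x))"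
    by (simp add: power2_eq_square algebra_simps)
  also have "\<dots> = energy P Q - energy (map_pmf g P) (map_pmf g Q)"
    using integrable_products cross_term by (simp add: energy_def r_def \<rho>_def power2_eq_square)
  finally show ?thesis by (simp add: r_def \<rho>_def)
qed

lemma energy_increment:
  assumes dom: "dominated K P Q"
  shows "(pmf (map_pmf h Q) d - predicted_prob P Q g h d)\<^sup>2
      \<le> energy P Q - energy (map_pmf g P) (map_pmf g Q)"
proof -
  let ?r = "rel_density P Q" and ?s = "\<lambda>x. rel_density (map_pmf g P) (map_pmf g Q) (g x)"
  note dom_g = dominated_map_pmf[OF dom, of g]
  have diff: "\<bar>?r x - ?s x\<bar> \<le> K" for x
    by (rule abs_rel_density_diff_le[OF dom dom_g])
  have diff_power2: "(?r x - ?s x)\<^sup>2 \<le> K\<^sup>2" for x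
    using power_mono[OF diff abs_ge_zero, of x 2] by simp
  have "pmf (map_pmf h Q) d - predicted_prob P Q g h d
      = measure_pmf.expectation P (\<lambda>x. ?r x * of_bool (h x = d))
        - measure_pmf.expectation P (\<lambda>x. ?s x * of_bool (h x = d))"
    by (simp add: pmf_map_eq_expectation predicted_prob_def
        expectation_rel_density[OF dominated_set_pmf_subset[OF dom]])
  also have "\<dots> = measure_pmf.expectation P
      (\<lambda>x. ?r x * of_bool (h x = d) - ?s x * of_bool (h x = d))"
    by (intro Bochner_Integration.integral_diff[symmetric] integrable_rel_density_of_bool[OF dom_g]
        integrable_rel_density_of_bool[OF dom, where f = "\<lambda>x. x"])
  also have "\<dots> = measure_pmf.expectation P (\<lambda>x. (?r x - ?s x) * of_bool (h x = d))"
    by (simp add: left_diff_distrib)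
  also have "\<dots>\<^sup>2 \<le> measure_pmf.expectation P (\<lambda>x. ((?r x - ?s x) * of_bool (h x = d))\<^sup>2)"
    using diff dominated_nonneg[OF dom] by (intro power2_expectation_le[where B = K]) auto
  also have "\<dots> \<le> measure_pmf.expectation P (\<lambda>x. (?r x - ?s x)\<^sup>2)"
    using diff_power2 by (intro integral_mono integrable_pmf_bounded[where B = "K\<^sup>2"]) auto
  also have "\<dots> = energy P Q - energy (map_pmf g P) (map_pmf g Q)"
    by (rule expectation_power2_rel_density_diff[OF dom])
  finally show ?thesis .
qed

lemma predicted_prob_map_pmf:
  "predicted_prob (map_pmf f P) (map_pmf f Q) g h d
    = predicted_prob P Q (\<lambda>x. g (f x)) (\<lambda>x. h (f x)) d"
  by (simp add: predicted_prob_def pmf.map_comp o_def)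

lemma predicted_prob_diff_le:
  assumes "finite Z" "g ` set_pmf P \<subseteq> Z" and dom: "dominated K P Q" "dominated K P Q'"
  shows "\<bar>predicted_prob P Q g h d - predicted_prob P Q' g h d\<bar>
      \<le> (\<Sum>y\<in>Z. \<bar>pmf (map_pmf g Q) y - pmf (map_pmf g Q') y\<bar>)"
proof -
  let ?r = "rel_density (map_pmf g P) (map_pmf g Q)"
  let ?r' = "rel_density (map_pmf g P) (map_pmf g Q')"
  note dom_g = dom[THEN dominated_map_pmf, of g]
  have "predicted_prob P Q g h d - predicted_prob P Q' g h d
      = measure_pmf.expectation P
          (\<lambda>x. ?r (g x) * of_bool (h x = d) - ?r' (g x) * of_bool (h x = d))"
    unfolding predicted_prob_def
    by (intro Bochner_Integration.integral_diff[symmetric]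
        dom_g[THEN integrable_rel_density_of_bool])
  also have "\<bar>\<dots>\<bar> \<le> measure_pmf.expectation P
      (\<lambda>x. \<bar>?r (g x) * of_bool (h x = d) - ?r' (g x) * of_bool (h x = d)\<bar>)"
    by (rule integral_abs_bound)
  also have "\<dots> \<le> measure_pmf.expectation P (\<lambda>x. \<bar>?r (g x) - ?r' (g x)\<bar>)"
    using abs_rel_density_diff_le[OF dom_g] dominated_nonneg[OF dom(1)]
    by (intro integral_mono integrable_pmf_bounded[where B = K]) auto
  also have "\<dots> = measure_pmf.expectation (map_pmf g P) (\<lambda>y. \<bar>?r y - ?r' y\<bar>)" by simp
  also have "\<dots> = (\<Sum>y\<in>Z. \<bar>?r y - ?r' y\<bar> * pmf (map_pmf g P) y)"
    using assms(1,2) by (intro integral_measure_pmf_real) auto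
  also have "\<dots> \<le> (\<Sum>y\<in>Z. \<bar>pmf (map_pmf g Q) y - pmf (map_pmf g Q') y\<bar>)"
    by (intro sum_mono) (auto simp: rel_density_def simp flip: diff_divide_distrib)
  finally show ?thesis .
qed

section \<open>Additive characters and large Fourier coefficients\<close>

definition add_char :: "nat \<Rightarrow> int \<Rightarrow> complex" where
  "add_char p k = cis (2 * pi * real_of_int k / real p)"

lemma norm_add_char [simp]: "norm (add_char p k) = 1"
  by (simp add: add_char_def)

lemma add_char_0 [simp]: "add_char p 0 = 1"
  by (simp add: add_char_def)

lemma add_char_add: "add_char p (j + k) = add_char p j * add_char p k"
  by (simp add: add_char_def cis_mult add_divide_distrib distrib_left)

lemma cnj_add_char: "cnj (add_char p k) = add_char p (- k)"
  by (simp add: add_char_def cis_cnj)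

lemma add_char_sum: "add_char p (\<Sum>i\<in>I. f i) = (\<Prod>i\<in>I. add_char p (f i))"
  by (induction I rule: infinite_finite_induct) (auto simp: add_char_add)

lemma add_char_power: "add_char p (int c * k) = add_char p k ^ c"
  by (induction c) (auto simp: distrib_right add_char_add)

lemma add_char_eq_1_iff:
  assumes "p > 0" shows "add_char p k = 1 \<longleftrightarrow> int p dvd k"
proof -
  have "2 * pi * real_of_int k / real p = of_int j * (2 * pi) \<longleftrightarrow> k = int p * j" for j :: int
  proof -
    have "2 * pi * real_of_int k / real p = of_int j * (2 * pi)
        \<longleftrightarrow> real_of_int k = real_of_int (int p * j)"
      using assms by (simp add: field_simps)
    then show ?thesis by (simp only: of_int_eq_iff)
  qed
  then show ?thesis by (simp add: add_char_def cis_eq_1_iff dvd_def)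
qed

lemma add_char_mod:
  assumes "p > 0" shows "add_char p (k mod int p) = add_char p k"
proof -
  have "add_char p k = add_char p (k mod int p + int p * (k div int p))" by simp
  also have "\<dots> = add_char p (k mod int p)"
    by (subst add_char_add) (simp add: add_char_eq_1_iff[OF assms])
  finally show ?thesis by simp
qed

lemma sum_add_char:
  assumes "p > 0"
  shows "(\<Sum>c<p. add_char p (int c * k)) = of_nat p * of_bool (int p dvd k)"
proof (cases "int p dvd k")
  case True
  then have "add_char p (int c * k) = 1" for c
    by (simp add: add_char_eq_1_iff[OF assms])
  then show ?thesis using True by simp
next
  case False
  then have "add_char p k \<noteq> 1" by (simp add: add_char_eq_1_iff[OF assms])
  moreover have "add_char p k ^ p = 1"
    by (simp add: add_char_eq_1_iff[OF assms] flip: add_char_power)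
  ultimately show ?thesis
    using False by (simp add: add_char_power geometric_sum)
qed

lemma near_uniform_if_small_fourier_coeffs:
  fixes u :: "'a \<Rightarrow> int"
  assumes p: "p > 0" and "0 \<le> \<eta>" and d: "d \<in> {0..int p - 1}"
    and small: "\<And>c. c \<in> {1..<p} \<Longrightarrow>
      norm (measure_pmf.expectation P (\<lambda>x. add_char p (int c * u x))) \<le> \<eta>"
  shows "\<bar>pmf (map_pmf (\<lambda>x. u x mod int p) P) d - 1 / real p\<bar> \<le> \<eta>"
proof -
  let ?q = "pmf (map_pmf (\<lambda>x. u x mod int p) P) d"
  let ?T = "\<lambda>c. add_char p (- (int c * d))
    * measure_pmf.expectation P (\<lambda>x. add_char p (int c * u x))"
  have add_char_diff: "add_char p (int c * (u x - d))
      = add_char p (- (int c * d)) * add_char p (int c * u x)" for c x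
    by (simp add: right_diff_distrib flip: add_char_add)
  have dvd_iff: "u x mod int p = d \<longleftrightarrow> int p dvd u x - d" for x
    using d p mod_pos_pos_trivial[of d "int p"] by (auto simp: mod_eq_dvd_iff[symmetric])
  have "complex_of_real (real p * ?q)
      = measure_pmf.expectation P (\<lambda>x. complex_of_real (real p * of_bool (u x mod int p = d)))"
    by (simp add: pmf_map_eq_expectation)
  also have "\<dots> = measure_pmf.expectation P (\<lambda>x. \<Sum>c<p. add_char p (int c * (u x - d)))"
    by (intro Bochner_Integration.integral_cong) (simp_all add: sum_add_char[OF p] dvd_iff)
  also have "\<dots> = (\<Sum>c<p. measure_pmf.expectation P (\<lambda>x. add_char p (int c * (u x - d))))"
    by (intro Bochner_Integration.integral_sum integrable_pmf_bounded[where B = 1]) simp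
  also have "\<dots> = (\<Sum>c<p. ?T c)"
    by (simp add: add_char_diff)
  also have "\<dots> = 1 + (\<Sum>c=1..<p. ?T c)"
    using p by (simp add: sum.atLeast_Suc_lessThan lessThan_atLeast0)
  finally have "complex_of_real (real p * ?q - 1) = (\<Sum>c=1..<p. ?T c)" by simp
  then have "\<bar>real p * ?q - 1\<bar> = norm (\<Sum>c=1..<p. ?T c)"
    by (metis norm_of_real)
  also have "\<dots> \<le> (\<Sum>c=1..<p. \<eta>)"
    using small by (intro sum_norm_le) (simp add: norm_mult)
  also have "\<dots> \<le> real p * \<eta>"
    using p \<open>0 \<le> \<eta>\<close> by (auto intro!: mult_right_mono)
  also have "\<bar>real p * ?q - 1\<bar> = real p * \<bar>?q - 1 / real p\<bar>"
    using p abs_mult[of "real p" "?q - 1 / real p"] by (simp add: right_diff_distrib)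
  finally show ?thesis using p by simp
qed

lemma expectation_norm_sum_power2_le:
  fixes f :: "'f \<Rightarrow> 'a \<Rightarrow> complex"
  assumes f: "\<And>a x. a \<in> S \<Longrightarrow> norm (f a x) \<le> 1"
  shows "measure_pmf.expectation P (\<lambda>x. (norm (\<Sum>a\<in>S. f a x))\<^sup>2)
      \<le> (\<Sum>a\<in>S. \<Sum>b\<in>S. norm (measure_pmf.expectation P (\<lambda>x. f a x * cnj (f b x))))"
proof -
  have "integrable P (\<lambda>x. f a x * cnj (f b x))" if "a \<in> S" "b \<in> S" for a b
    using f that by (intro integrable_pmf_bounded[where B = 1]) (auto simp: norm_mult mult_le_one)
  then have "measure_pmf.expectation P (\<lambda>x. \<Sum>a\<in>S. \<Sum>b\<in>S. f a x * cnj (f b x))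
      = (\<Sum>a\<in>S. \<Sum>b\<in>S. measure_pmf.expectation P (\<lambda>x. f a x * cnj (f b x)))"
    by (simp add: Bochner_Integration.integral_sum Bochner_Integration.integrable_sum)
  moreover have "complex_of_real ((norm (\<Sum>a\<in>S. f a x))\<^sup>2)
      = (\<Sum>a\<in>S. \<Sum>b\<in>S. f a x * cnj (f b x))" for x
    by (simp only: complex_norm_square cnj_sum sum_product)
  ultimately have "complex_of_real (measure_pmf.expectation P (\<lambda>x. (norm (\<Sum>a\<in>S. f a x))\<^sup>2))
      = (\<Sum>a\<in>S. \<Sum>b\<in>S. measure_pmf.expectation P (\<lambda>x. f a x * cnj (f b x)))"
    by (simp only: flip: integral_complex_of_real)
  from arg_cong[OF this, of norm]
  have "\<bar>measure_pmf.expectation P (\<lambda>x. (norm (\<Sum>a\<in>S. f a x))\<^sup>2)\<bar>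
      = norm (\<Sum>a\<in>S. \<Sum>b\<in>S. measure_pmf.expectation P (\<lambda>x. f a x * cnj (f b x)))"
    by (simp only: norm_of_real)
  also have "\<dots> \<le> (\<Sum>a\<in>S. \<Sum>b\<in>S. norm (measure_pmf.expectation P (\<lambda>x. f a x * cnj (f b x))))"
    by (intro sum_norm_le) simp
  finally show ?thesis by simp
qed

lemma cnj_sgn_mult: "cnj (sgn z) * z = of_real (norm z)"
proof (cases "z = 0")
  case False
  have "cnj (sgn z) * z = z * cnj z / of_real (norm z)" by (simp add: sgn_eq)
  also have "\<dots> = of_real (norm z)"
    using False by (simp add: power2_eq_square flip: complex_norm_square)
  finally show ?thesis .
qed simp

lemma power2_sum_norm_expectation_le_duality:
  fixes e :: "'f \<Rightarrow> 'a \<Rightarrow> complex"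
  assumes dom: "dominated K P Q" and e: "\<And>a x. a \<in> S \<Longrightarrow> norm (e a x) \<le> 1"
  shows "\<exists>\<theta>. (\<forall>a. norm (\<theta> a) \<le> 1) \<and>
    (\<Sum>a\<in>S. norm (measure_pmf.expectation Q (e a)))\<^sup>2
      \<le> K * measure_pmf.expectation P (\<lambda>x. (norm (\<Sum>a\<in>S. \<theta> a * e a x))\<^sup>2)"
proof -
  define \<theta> where "\<theta> a = cnj (sgn (measure_pmf.expectation Q (e a)))" for a
  have \<theta>: "norm (\<theta> a) \<le> 1" for a by (simp add: \<theta>_def norm_sgn)
  have norm_term: "norm (\<theta> a * e a x) \<le> 1" if "a \<in> S" for a x
    using e[OF that] \<theta> by (simp add: norm_mult mult_le_one)
  then have norm_sum_le: "norm (\<Sum>a\<in>S. \<theta> a * e a x) \<le> real (card S)" for x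
    by (intro order_trans[OF norm_sum] order_trans[OF sum_bounded_above[where K = 1]]) auto
  have "measure_pmf.expectation Q (\<lambda>x. \<Sum>a\<in>S. \<theta> a * e a x)
      = of_real (\<Sum>a\<in>S. norm (measure_pmf.expectation Q (e a)))"
    using norm_term by (subst Bochner_Integration.integral_sum)
      (auto intro: integrable_pmf_bounded simp: \<theta>_def cnj_sgn_mult)
  from arg_cong[OF this, of norm]
  have "(\<Sum>a\<in>S. norm (measure_pmf.expectation Q (e a)))
      = norm (measure_pmf.expectation Q (\<lambda>x. \<Sum>a\<in>S. \<theta> a * e a x))"
    by (simp only: norm_of_real abs_of_nonneg sum_nonneg norm_ge_zero)
  also have "\<dots> \<le> measure_pmf.expectation Q (\<lambda>x. norm (\<Sum>a\<in>S. \<theta> a * e a x))"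
    by (rule integral_norm_bound)
  finally have "(\<Sum>a\<in>S. norm (measure_pmf.expectation Q (e a)))\<^sup>2
      \<le> (measure_pmf.expectation Q (\<lambda>x. norm (\<Sum>a\<in>S. \<theta> a * e a x)))\<^sup>2"
    by (intro power_mono) (simp_all add: sum_nonneg)
  also have "\<dots> \<le> measure_pmf.expectation Q (\<lambda>x. (norm (\<Sum>a\<in>S. \<theta> a * e a x))\<^sup>2)"
    using norm_sum_le by (intro power2_expectation_le) auto
  also have "\<dots> \<le> K * measure_pmf.expectation P (\<lambda>x. (norm (\<Sum>a\<in>S. \<theta> a * e a x))\<^sup>2)"
    using power_mono[OF norm_sum_le norm_ge_zero]
    by (intro expectation_le_if_dominated[OF dom]) auto
  finally show ?thesis using \<theta> by blast
qed

lemma halasz_montgomery_inequality: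
  fixes e :: "'f \<Rightarrow> 'a \<Rightarrow> complex"
  assumes dom: "dominated K P Q" and e: "\<And>a x. a \<in> S \<Longrightarrow> norm (e a x) \<le> 1"
  shows "(\<Sum>a\<in>S. norm (measure_pmf.expectation Q (e a)))\<^sup>2
      \<le> K * (\<Sum>a\<in>S. \<Sum>b\<in>S. norm (measure_pmf.expectation P (\<lambda>x. e a x * cnj (e b x))))"
proof -
  obtain \<theta> where \<theta>: "\<And>a. norm (\<theta> a) \<le> 1"
    and dual: "(\<Sum>a\<in>S. norm (measure_pmf.expectation Q (e a)))\<^sup>2
      \<le> K * measure_pmf.expectation P (\<lambda>x. (norm (\<Sum>a\<in>S. \<theta> a * e a x))\<^sup>2)"
    using power2_sum_norm_expectation_le_duality[where e = e, OF assms] by auto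
  note dual
  also have "K * measure_pmf.expectation P (\<lambda>x. (norm (\<Sum>a\<in>S. \<theta> a * e a x))\<^sup>2)
      \<le> K * (\<Sum>a\<in>S. \<Sum>b\<in>S.
          norm (measure_pmf.expectation P (\<lambda>x. \<theta> a * e a x * cnj (\<theta> b * e b x))))"
    using e \<theta>
    by (intro mult_left_mono expectation_norm_sum_power2_le dominated_nonneg[OF dom])
      (simp add: norm_mult mult_le_one)
  also have "\<dots> \<le> K * (\<Sum>a\<in>S. \<Sum>b\<in>S.
      norm (measure_pmf.expectation P (\<lambda>x. e a x * cnj (e b x))))"
  proof (intro mult_left_mono sum_mono dominated_nonneg[OF dom])
    fix a b
    have "measure_pmf.expectation P (\<lambda>x. \<theta> a * e a x * cnj (\<theta> b * e b x))
        = \<theta> a * cnj (\<theta> b) * measure_pmf.expectation P (\<lambda>x. e a x * cnj (e b x))"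
      by (simp add: mult_ac flip: integral_mult_right_zero)
    moreover have "norm (\<theta> a * cnj (\<theta> b)) \<le> 1"
      using \<theta> by (simp add: norm_mult mult_le_one)
    ultimately show "norm (measure_pmf.expectation P (\<lambda>x. \<theta> a * e a x * cnj (\<theta> b * e b x)))
        \<le> norm (measure_pmf.expectation P (\<lambda>x. e a x * cnj (e b x)))"
      by (simp add: norm_mult mult_left_le_one_le)
  qed
  finally show ?thesis .
qed

lemma card_le_if_large_coeffs_almost_orthogonal:
  fixes e :: "'f \<Rightarrow> 'a \<Rightarrow> complex"
  assumes dom: "dominated K P Q" and e: "\<And>a x. a \<in> S \<Longrightarrow> norm (e a x) \<le> 1"
    and "finite S" "0 < \<eta>" "0 \<le> \<kappa>" "K * \<kappa> \<le> \<eta>\<^sup>2 / 2"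
    and large: "\<And>a. a \<in> S \<Longrightarrow> \<eta> \<le> norm (measure_pmf.expectation Q (e a))"
    and orth: "\<And>a b. a \<in> S \<Longrightarrow> b \<in> S \<Longrightarrow> a \<noteq> b \<Longrightarrow>
      norm (measure_pmf.expectation P (\<lambda>x. e a x * cnj (e b x))) \<le> \<kappa>"
  shows "real (card S) \<le> 2 * K / \<eta>\<^sup>2"
proof -
  let ?s = "real (card S)"
  have K: "0 \<le> K" by (rule dominated_nonneg[OF dom])
  have inner_le: "norm (measure_pmf.expectation P (\<lambda>x. e a x * cnj (e b x))) \<le> of_bool (a = b) + \<kappa>"
    if "a \<in> S" "b \<in> S" for a b
  proof (cases "a = b")
    case True
    then show ?thesis
      using e[OF that(1)] \<open>0 \<le> \<kappa>\<close> norm_expectation_le[of "\<lambda>x. e a x * cnj (e a x)" 1 P]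
      by (simp add: norm_mult mult_le_one)
  next
    case False
    then show ?thesis using orth[OF that] by simp
  qed
  have "?s * \<eta> \<le> (\<Sum>a\<in>S. norm (measure_pmf.expectation Q (e a)))"
    using large by (intro sum_bounded_below)
  then have "(?s * \<eta>)\<^sup>2 \<le> (\<Sum>a\<in>S. norm (measure_pmf.expectation Q (e a)))\<^sup>2"
    using \<open>0 < \<eta>\<close> by (intro power_mono) auto
  also have "\<dots> \<le> K * (\<Sum>a\<in>S. \<Sum>b\<in>S. norm (measure_pmf.expectation P (\<lambda>x. e a x * cnj (e b x))))"
    by (rule halasz_montgomery_inequality[OF dom e])
  also have "\<dots> \<le> K * (\<Sum>a\<in>S. \<Sum>b\<in>S. of_bool (a = b) + \<kappa>)"
    using K inner_le by (intro mult_left_mono sum_mono) auto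
  also have "\<dots> = K * ?s + ?s\<^sup>2 * (K * \<kappa>)"
    using \<open>finite S\<close> by (simp add: sum.distrib of_bool_def algebra_simps power2_eq_square)
  also have "\<dots> \<le> K * ?s + ?s\<^sup>2 * (\<eta>\<^sup>2 / 2)"
    using assms(6) by (intro add_left_mono mult_left_mono) auto
  finally have "?s * (?s * \<eta>\<^sup>2) \<le> ?s * (2 * K)"
    by (simp add: power_mult_distrib power2_eq_square algebra_simps)
  then have "?s * \<eta>\<^sup>2 \<le> 2 * K"
    using K by (cases "card S = 0") auto
  then show ?thesis using \<open>0 < \<eta>\<close> by (simp add: field_simps)
qed

section \<open>Biased forms on the cube\<close>

definition lform :: "nat \<Rightarrow> (nat \<Rightarrow> int) \<Rightarrow> (nat \<Rightarrow> int) \<Rightarrow> int" where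
  "lform n a x = (\<Sum>i\<in>{1..n}. a i * x i)"

definition hamming :: "'i set \<Rightarrow> ('i \<Rightarrow> 'v) \<Rightarrow> ('i \<Rightarrow> 'v) \<Rightarrow> nat" where
  "hamming J a b = card {i \<in> J. a i \<noteq> b i}"

lemma finite_cube [simp]: "finite (cube n)"
  by (simp add: cube_def finite_PiE)

lemma card_cube: "card (cube n) = 2 ^ n"
  by (simp add: cube_def card_PiE numeral_2_eq_2)

lemma cube_nonempty [simp]: "cube n \<noteq> {}"
  using card_cube[of n] by auto

lemma F_space_eq: "F_space p n = {1..n} \<rightarrow>\<^sub>E {0..int p - 1}"
  by (simp add: F_space_def residue_ring_def)

lemma finite_F_space [simp]: "finite (F_space p n)"
  by (simp add: F_space_eq finite_PiE)

lemma expectation_cube_add_char: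
  "measure_pmf.expectation (pmf_of_set (cube n)) (\<lambda>x. add_char p (lform n b x))
    = (\<Prod>i\<in>{1..n}. (1 + add_char p (b i)) / 2)"
proof -
  have "(\<Prod>i\<in>{1..n}. \<Sum>v\<in>{0,1::int}. add_char p (b i * v))
      = (\<Sum>x\<in>cube n. \<Prod>i\<in>{1..n}. add_char p (b i * x i))"
    unfolding cube_def by (intro prod_sum_PiE) auto
  then have "(\<Sum>x\<in>cube n. add_char p (lform n b x)) = (\<Prod>i\<in>{1..n}. 1 + add_char p (b i))"
    by (simp add: lform_def add_char_sum)
  then show ?thesis
    by (subst integral_measure_pmf[of "cube n"])
      (simp_all add: card_cube prod_dividef scaleR_conv_of_real flip: sum_divide_distrib)
qed

lemma norm_1_plus_less_2:
  fixes z :: complex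
  assumes "norm z = 1" "z \<noteq> 1"
  shows "norm (1 + z) < 2"
  using assms norm_triangle_eq[of 1 z] norm_triangle_ineq[of 1 z] by auto

text \<open>The inserted \<open>0\<close> covers \<open>p \<le> 1\<close>, where the maximum would be over the empty set.\<close>

definition char_decay :: "nat \<Rightarrow> real" where
  "char_decay p = Max (insert 0 ((\<lambda>k. norm ((1 + add_char p k) / 2)) ` {1..<int p}))"

lemma char_decay_nonneg: "0 \<le> char_decay p"
  by (simp add: char_decay_def)

lemma char_decay_less_1:
  assumes "p > 0" shows "char_decay p < 1"
proof -
  have "norm (1 + add_char p k) < 2" if "k \<in> {1..<int p}" for k
    using that zdvd_not_zless[of k "int p"]
    by (intro norm_1_plus_less_2) (simp_all add: add_char_eq_1_iff[OF assms])
  then show ?thesis by (simp add: char_decay_def norm_divide)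
qed

lemma norm_half_1_plus_add_char_le:
  assumes "p > 0" "\<not> int p dvd k"
  shows "norm ((1 + add_char p k) / 2) \<le> char_decay p"
proof -
  have "k mod int p \<in> {1..<int p}"
    using assms pos_mod_bound[of "int p" k] pos_mod_sign[of "int p" k]
    unfolding dvd_eq_mod_eq_0 atLeastLessThan_iff by linarith
  then have "norm ((1 + add_char p (k mod int p)) / 2) \<le> char_decay p"
    unfolding char_decay_def by (intro Max_ge) auto
  then show ?thesis by (simp add: add_char_mod[OF assms(1)])
qed

lemma norm_expectation_cube_add_char_le:
  assumes "p > 0"
  shows "norm (measure_pmf.expectation (pmf_of_set (cube n)) (\<lambda>x. add_char p (lform n b x)))
      \<le> char_decay p ^ card {i \<in> {1..n}. \<not> int p dvd b i}"
proof -
  have "norm (measure_pmf.expectation (pmf_of_set (cube n)) (\<lambda>x. add_char p (lform n b x)))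
      = (\<Prod>i\<in>{1..n}. norm ((1 + add_char p (b i)) / 2))"
    by (simp add: expectation_cube_add_char flip: prod_norm)
  also have "\<dots> \<le> (\<Prod>i\<in>{1..n}. if \<not> int p dvd b i then char_decay p else 1)"
  proof (intro prod_mono conjI)
    fix i
    have "norm (1 + add_char p (b i)) \<le> 2"
      using norm_triangle_ineq[of 1 "add_char p (b i)"] by simp
    then show "norm ((1 + add_char p (b i)) / 2)
        \<le> (if \<not> int p dvd b i then char_decay p else 1)"
      using norm_half_1_plus_add_char_le[OF assms, of "b i"] by (auto simp: norm_divide)
  qed auto
  also have "\<dots> = char_decay p ^ card {i \<in> {1..n}. \<not> int p dvd b i}"
    by (simp flip: prod.inter_filter)
  finally show ?thesis .
qed

lemma hamming_self [simp]: "hamming J a a = 0"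
  by (simp add: hamming_def)

lemma hamming_commute: "hamming J a b = hamming J b a"
  by (simp add: hamming_def eq_commute)

lemma hamming_ball_Suc_subset:
  assumes "a \<in> J \<rightarrow>\<^sub>E V" "finite J"
  shows "{b \<in> J \<rightarrow>\<^sub>E V. hamming J a b \<le> Suc L}
      \<subseteq> {b \<in> J \<rightarrow>\<^sub>E V. hamming J a b \<le> L}
        \<union> (\<lambda>(b, i, v). b(i := v)) ` ({b \<in> J \<rightarrow>\<^sub>E V. hamming J a b \<le> L} \<times> J \<times> V)"
    (is "_ \<subseteq> ?B \<union> ?U")
proof
  fix b assume b: "b \<in> {b \<in> J \<rightarrow>\<^sub>E V. hamming J a b \<le> Suc L}"
  show "b \<in> ?B \<union> ?U"
  proof (cases "hamming J a b \<le> L")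
    case False
    then have "hamming J a b \<noteq> 0" by linarith
    then obtain i where i: "i \<in> J" "a i \<noteq> b i"
      by (metis (mono_tags, lifting) card.empty empty_Collect_eq hamming_def)
    have "{j \<in> J. a j \<noteq> (b(i := a i)) j} = {j \<in> J. a j \<noteq> b j} - {i}" by auto
    then have "hamming J a (b(i := a i)) = hamming J a b - 1"
      using i assms(2) by (simp add: hamming_def)
    moreover have "b(i := a i) \<in> J \<rightarrow>\<^sub>E V"
      using assms(1) b i by (auto simp: PiE_iff extensional_def)
    ultimately have "b(i := a i) \<in> ?B" using b by auto
    moreover have "b = (b(i := a i))(i := b i)" by simp
    moreover have "b i \<in> V" using b i by auto
    ultimately show ?thesis
      using i by (intro UnI2 image_eqI[where x = "(b(i := a i), i, b i)"]) auto
  qed (use b in auto)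
qed

lemma card_hamming_ball_le:
  assumes "a \<in> J \<rightarrow>\<^sub>E V" "finite J" "finite V"
  shows "card {b \<in> J \<rightarrow>\<^sub>E V. hamming J a b \<le> L} \<le> (1 + card J * card V) ^ L"
proof (induction L)
  case 0
  have "b = a" if "b \<in> J \<rightarrow>\<^sub>E V" "hamming J a b = 0" for b
    using that assms by (intro PiE_ext[OF that(1) assms(1)]) (auto simp: hamming_def)
  then have "{b \<in> J \<rightarrow>\<^sub>E V. hamming J a b \<le> 0} \<subseteq> {a}" by auto
  then show ?case using card_mono[of "{a}"] by fastforce
next
  case (Suc L)
  let ?B = "\<lambda>L. {b \<in> J \<rightarrow>\<^sub>E V. hamming J a b \<le> L}"
  let ?U = "(\<lambda>(b, i, v). b(i := v)) ` (?B L \<times> J \<times> V)"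
  have fin: "finite (?B L)" using assms by (simp add: finite_PiE)
  have "card (?B (Suc L)) \<le> card (?B L \<union> ?U)"
    using fin assms by (intro card_mono hamming_ball_Suc_subset) auto
  also have "\<dots> \<le> card (?B L) + card ?U" by (rule card_Un_le)
  also have "card ?U \<le> card (?B L \<times> J \<times> V)"
    using fin assms by (intro card_image_le) auto
  also have "\<dots> = card (?B L) * (card J * card V)" by (simp add: card_cartesian_product)
  finally have "card (?B (Suc L)) \<le> card (?B L) * (1 + card J * card V)" by simp
  also have "\<dots> \<le> (1 + card J * card V) ^ L * (1 + card J * card V)"
    using Suc.IH by (rule mult_right_mono) simp
  finally show ?case by (simp add: mult.commute)
qed

lemma exists_separated_covering_subset:
  assumes "finite X" "\<And>x. near x x" "\<And>x y. near x y \<Longrightarrow> near y x"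
  shows "\<exists>S\<subseteq>X. (\<forall>x\<in>S. \<forall>y\<in>S. x \<noteq> y \<longrightarrow> \<not> near x y) \<and> (\<forall>x\<in>X. \<exists>s\<in>S. near s x)"
  using assms(1)
proof (induction X)
  case (insert x X)
  then obtain S where S: "S \<subseteq> X" "\<forall>x\<in>S. \<forall>y\<in>S. x \<noteq> y \<longrightarrow> \<not> near x y" "\<forall>x\<in>X. \<exists>s\<in>S. near s x"
    by blast
  show ?case
  proof (cases "\<exists>s\<in>S. near s x")
    case True
    then show ?thesis using S by (intro exI[of _ S]) auto
  next
    case False
    then have "\<forall>s\<in>S. \<not> near s x \<and> \<not> near x s" using assms(3) by blast
    then show ?thesis using S assms(2) by (intro exI[of _ "insert x S"]) auto
  qed
qed auto

definition large_spectrum :: "nat \<Rightarrow> nat \<Rightarrow> int \<Rightarrow> real \<Rightarrow> (nat \<Rightarrow> int) pmf \<Rightarrow> (nat \<Rightarrow> int) set" where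
  "large_spectrum p n c \<eta> Q = {a \<in> F_space p n.
     \<eta> \<le> norm (measure_pmf.expectation Q (\<lambda>x. add_char p (c * lform n a x)))}"

definition biased_forms :: "nat \<Rightarrow> nat \<Rightarrow> real \<Rightarrow> (nat \<Rightarrow> int) pmf \<Rightarrow> (nat \<Rightarrow> int) set" where
  "biased_forms p n \<eta> Q = {a \<in> F_space p n. \<exists>d\<in>{0..int p - 1}.
     \<eta> < \<bar>pmf (map_pmf (\<lambda>x. lform n a x mod int p) Q) d - 1 / real p\<bar>}"

lemma norm_expectation_cube_distinct_forms_le:
  assumes p: "prime p" and c: "\<not> int p dvd c" and ab: "a \<in> F_space p n" "b \<in> F_space p n"
  shows "norm (measure_pmf.expectation (pmf_of_set (cube n))
      (\<lambda>x. add_char p (c * lform n a x) * cnj (add_char p (c * lform n b x))))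
    \<le> char_decay p ^ hamming {1..n} a b"
proof -
  have "int p dvd c * (a i - b i) \<longleftrightarrow> a i = b i" if "i \<in> {1..n}" for i
  proof -
    have "a i \<in> {0..int p - 1}" "b i \<in> {0..int p - 1}"
      using ab that by (auto simp: F_space_eq PiE_iff)
    then have "int p dvd a i - b i \<longleftrightarrow> a i = b i"
      using mod_pos_pos_trivial[of "a i" "int p"] mod_pos_pos_trivial[of "b i" "int p"]
      by (auto simp: mod_eq_dvd_iff[symmetric])
    then show ?thesis using p c by (simp add: prime_dvd_mult_iff)
  qed
  then have "{i \<in> {1..n}. \<not> int p dvd c * (a i - b i)} = {i \<in> {1..n}. a i \<noteq> b i}" by auto
  moreover have "add_char p (c * lform n a x) * cnj (add_char p (c * lform n b x))
      = add_char p (lform n (\<lambda>i. c * (a i - b i)) x)" for x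
    by (simp add: cnj_add_char lform_def sum_distrib_left algebra_simps
        flip: add_char_add sum_subtractf)
  ultimately show ?thesis
    using norm_expectation_cube_add_char_le[OF prime_gt_0_nat[OF p], of n "\<lambda>i. c * (a i - b i)"]
    by (simp add: hamming_def)
qed

lemma card_separated_large_spectrum_le:
  assumes p: "prime p" and c: "\<not> int p dvd c" and "0 < \<eta>"
    and dom: "dominated K (pmf_of_set (cube n)) Q"
    and L: "K * char_decay p ^ L \<le> \<eta>\<^sup>2 / 2"
    and S: "S \<subseteq> large_spectrum p n c \<eta> Q"
    and sep: "\<And>a b. a \<in> S \<Longrightarrow> b \<in> S \<Longrightarrow> a \<noteq> b \<Longrightarrow> L \<le> hamming {1..n} a b"
  shows "real (card S) \<le> 2 * K / \<eta>\<^sup>2"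
proof (rule card_le_if_large_coeffs_almost_orthogonal[OF dom])
  have S_subset: "S \<subseteq> F_space p n" using S by (auto simp: large_spectrum_def)
  then show "finite S" by (rule finite_subset) simp
  show "norm (measure_pmf.expectation (pmf_of_set (cube n))
      (\<lambda>x. add_char p (c * lform n a x) * cnj (add_char p (c * lform n b x)))) \<le> char_decay p ^ L"
    if "a \<in> S" "b \<in> S" "a \<noteq> b" for a b
  proof (rule order_trans[OF norm_expectation_cube_distinct_forms_le[OF p c]])
    show "char_decay p ^ hamming {1..n} a b \<le> char_decay p ^ L"
      using sep[OF that] char_decay_nonneg char_decay_less_1[OF prime_gt_0_nat[OF p]]
      by (intro power_decreasing) auto
  qed (use S_subset that in auto)
qed (use assms char_decay_nonneg in \<open>auto simp: large_spectrum_def\<close>)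

lemma card_large_spectrum_le:
  assumes p: "prime p" and c: "\<not> int p dvd c" and "0 < \<eta>"
    and dom: "dominated K (pmf_of_set (cube n)) Q"
    and L: "K * char_decay p ^ L \<le> \<eta>\<^sup>2 / 2"
  shows "real (card (large_spectrum p n c \<eta> Q)) \<le> 2 * K / \<eta>\<^sup>2 * real ((1 + n * p) ^ L)"
proof -
  let ?X = "large_spectrum p n c \<eta> Q"
  let ?ball = "\<lambda>a. {b \<in> F_space p n. hamming {1..n} a b \<le> L}"
  have finite_X: "finite ?X" by (simp add: large_spectrum_def)
  have "\<exists>S\<subseteq>?X. (\<forall>a\<in>S. \<forall>b\<in>S. a \<noteq> b \<longrightarrow> \<not> hamming {1..n} a b \<le> L)
      \<and> (\<forall>a\<in>?X. \<exists>s\<in>S. hamming {1..n} s a \<le> L)"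
    by (intro exists_separated_covering_subset finite_X) (simp_all add: hamming_commute)
  then obtain S where "S \<subseteq> ?X" and separated: "\<forall>a\<in>S. \<forall>b\<in>S. a \<noteq> b \<longrightarrow> \<not> hamming {1..n} a b \<le> L"
    and covering: "\<forall>a\<in>?X. \<exists>s\<in>S. hamming {1..n} s a \<le> L"
    by (elim exE conjE)
  have finite_S: "finite S" using \<open>S \<subseteq> ?X\<close> finite_X by (rule finite_subset)
  have card_S: "real (card S) \<le> 2 * K / \<eta>\<^sup>2"
    using separated
    by (intro card_separated_large_spectrum_le[OF p c \<open>0 < \<eta>\<close> dom L \<open>S \<subseteq> ?X\<close>])
      (auto simp: not_le less_imp_le)
  have card_ball: "card (?ball s) \<le> (1 + n * p) ^ L" if "s \<in> S" for s
    using that \<open>S \<subseteq> ?X\<close> card_hamming_ball_le[of s "{1..n}" "{0..int p - 1}" L]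
    by (auto simp: large_spectrum_def F_space_eq)
  have "?X \<subseteq> (\<Union>s\<in>S. ?ball s)"
    using covering by (fastforce simp: large_spectrum_def)
  then have "card ?X \<le> card (\<Union>s\<in>S. ?ball s)"
    using finite_S by (intro card_mono) auto
  also have "\<dots> \<le> (\<Sum>s\<in>S. card (?ball s))"
    using finite_S by (rule card_UN_le)
  also have "\<dots> \<le> card S * (1 + n * p) ^ L"
    using sum_bounded_above[OF card_ball] by simp
  finally have "real (card ?X) \<le> real (card S) * real ((1 + n * p) ^ L)"
    by (metis of_nat_mono of_nat_mult)
  also have "\<dots> \<le> 2 * K / \<eta>\<^sup>2 * real ((1 + n * p) ^ L)"
    using card_S by (rule mult_right_mono) simp
  finally show ?thesis .
qed

lemma biased_forms_subset_large_spectrum: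
  assumes "p > 0" "0 < \<eta>"
  shows "biased_forms p n \<eta> Q \<subseteq> (\<Union>c\<in>{1..<p}. large_spectrum p n (int c) \<eta> Q)"
proof (rule subsetI, rule ccontr)
  fix a assume biased: "a \<in> biased_forms p n \<eta> Q"
    and "a \<notin> (\<Union>c\<in>{1..<p}. large_spectrum p n (int c) \<eta> Q)"
  then have "norm (measure_pmf.expectation Q (\<lambda>x. add_char p (int c * lform n a x))) \<le> \<eta>"
    if "c \<in> {1..<p}" for c
    using that by (auto simp: biased_forms_def large_spectrum_def not_le less_imp_le)
  then have "\<bar>pmf (map_pmf (\<lambda>x. lform n a x mod int p) Q) d - 1 / real p\<bar> \<le> \<eta>"
    if "d \<in> {0..int p - 1}" for d
    using that assms by (intro near_uniform_if_small_fourier_coeffs) auto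
  then show False using biased by (fastforce simp: biased_forms_def)
qed

lemma card_biased_forms_polynomial_bound:
  assumes p: "prime p" and "0 < K" "0 < \<eta>"
  shows "\<exists>M>0. \<exists>L. \<forall>n Q. dominated K (pmf_of_set (cube n)) Q \<longrightarrow>
    real (card (biased_forms p n \<eta> Q)) \<le> M * (real n + 1) ^ L"
proof -
  have p_pos: "p > 0" using p prime_gt_0_nat by simp
  obtain L where "char_decay p ^ L < \<eta>\<^sup>2 / 2 / K"
    using real_arch_pow_inv[of "\<eta>\<^sup>2 / 2 / K" "char_decay p"] char_decay_less_1[OF p_pos] assms
    by auto
  then have L: "K * char_decay p ^ L \<le> \<eta>\<^sup>2 / 2"
    using \<open>0 < K\<close> by (simp add: field_simps)
  define M where "M = real p * (2 * K / \<eta>\<^sup>2 * real p ^ L)"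
  have "real (card (biased_forms p n \<eta> Q)) \<le> M * (real n + 1) ^ L"
    if dom: "dominated K (pmf_of_set (cube n)) Q" for n Q
  proof -
    have "card (biased_forms p n \<eta> Q) \<le> card (\<Union>c\<in>{1..<p}. large_spectrum p n (int c) \<eta> Q)"
      using p_pos \<open>0 < \<eta>\<close>
      by (intro card_mono biased_forms_subset_large_spectrum) (auto simp: large_spectrum_def)
    also have "\<dots> \<le> (\<Sum>c\<in>{1..<p}. card (large_spectrum p n (int c) \<eta> Q))"
      by (rule card_UN_le) simp
    finally have "real (card (biased_forms p n \<eta> Q))
        \<le> (\<Sum>c\<in>{1..<p}. real (card (large_spectrum p n (int c) \<eta> Q)))"
      by (simp flip: of_nat_sum)
    also have "\<dots> \<le> (\<Sum>c\<in>{1..<p}. 2 * K / \<eta>\<^sup>2 * real ((1 + n * p) ^ L))"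
      using assms dom L
      by (intro sum_mono card_large_spectrum_le) (auto dest: zdvd_imp_le)
    also have "\<dots> = real (p - 1) * (2 * K / \<eta>\<^sup>2 * real ((1 + n * p) ^ L))" by simp
    also have "\<dots> \<le> real p * (2 * K / \<eta>\<^sup>2 * real ((1 + n * p) ^ L))"
      using \<open>0 < K\<close> by (intro mult_right_mono) auto
    also have "\<dots> \<le> real p * (2 * K / \<eta>\<^sup>2 * (real p * (real n + 1)) ^ L)"
      using \<open>0 < K\<close> p_pos
      by (auto intro!: mult_left_mono power_mono divide_right_mono simp: algebra_simps)
    finally show ?thesis by (simp add: M_def power_mult_distrib mult_ac)
  qed
  moreover have "M > 0" using assms p_pos by (simp add: M_def)
  ultimately show ?thesis by blast
qed

section \<open>Energy increment\<close>

lemma pigeonhole_close_functions: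
  fixes f :: "'i \<Rightarrow> 'y \<Rightarrow> real" and w :: nat
  assumes "finite R" "finite Z" "w > 0"
    and f: "\<And>i y. i \<in> R \<Longrightarrow> y \<in> Z \<Longrightarrow> 0 \<le> f i y \<and> f i y \<le> 1"
  shows "\<exists>R'\<subseteq>R. card R \<le> (w + 1) ^ card Z * card R' \<and>
    (\<forall>i\<in>R'. \<forall>i'\<in>R'. \<forall>y\<in>Z. \<bar>f i y - f i' y\<bar> \<le> 1 / real w)"
proof -
  define r where "r i = (\<lambda>y\<in>Z. nat \<lfloor>real w * f i y\<rfloor>)" for i
  have r_eq: "real (r i y) = of_int \<lfloor>real w * f i y\<rfloor>" if "i \<in> R" "y \<in> Z" for i y
    using f[OF that] that by (simp add: r_def)
  have r: "real (r i y) \<le> real w * f i y" "real w * f i y < real (r i y) + 1"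
    if "i \<in> R" "y \<in> Z" for i y
    unfolding r_eq[OF that] by linarith+
  have "r i \<in> Z \<rightarrow>\<^sub>E {0..w}" if "i \<in> R" for i
  proof -
    have "real (r i y) \<le> real w" if "y \<in> Z" for y
      using r(1)[OF \<open>i \<in> R\<close> that] f[OF \<open>i \<in> R\<close> that] mult_left_mono[of "f i y" 1 "real w"]
      by linarith
    then show ?thesis by (auto simp: r_def)
  qed
  then have "\<exists>g\<in>Z \<rightarrow>\<^sub>E {0..w}. card R \<le> card (r -` {g} \<inter> R) * card (Z \<rightarrow>\<^sub>E {0..w})"
    using assms by (intro pigeonhole_card) (auto simp: finite_PiE PiE_eq_empty_iff)
  then obtain g where g: "card R \<le> card (r -` {g} \<inter> R) * (w + 1) ^ card Z"
    using \<open>finite Z\<close> by (auto simp: card_PiE)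
  have "\<bar>f i y - f i' y\<bar> \<le> 1 / real w"
    if "i \<in> r -` {g} \<inter> R" "i' \<in> r -` {g} \<inter> R" "y \<in> Z" for i i' y
  proof -
    have "r i y = r i' y" using that by simp
    then have "\<bar>real w * f i y - real w * f i' y\<bar> \<le> 1"
      using r[of i y] r[of i' y] that by auto
    then have "real w * \<bar>f i y - f i' y\<bar> \<le> 1"
      by (simp add: abs_mult flip: right_diff_distrib)
    then show ?thesis using \<open>w > 0\<close> by (simp add: field_simps)
  qed
  then show ?thesis
    using g by (intro exI[of _ "r -` {g} \<inter> R"]) (auto simp: mult.commute)
qed

lemma card_constrained_PiE_le:
  fixes G :: "'i \<Rightarrow> 'i set" and g :: real
  assumes "finite R" "finite J" "j \<in> J" "j' \<in> J" "j \<noteq> j'"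
    and G: "\<And>i. i \<in> R \<Longrightarrow> G i \<subseteq> R" "\<And>i. i \<in> R \<Longrightarrow> real (card (G i)) \<le> g"
  shows "real (card {t \<in> J \<rightarrow>\<^sub>E R. t j \<in> G (t j')}) \<le> g * real (card R) ^ (card J - 1)"
proof -
  let ?P = "(J - {j}) \<rightarrow>\<^sub>E R"
  let ?S = "Sigma ?P (\<lambda>u. G (u j'))"
  have finite_P: "finite ?P" using assms(1,2) by (simp add: finite_PiE)
  have value_in_R: "u j' \<in> R" if "u \<in> ?P" for u using that assms by auto
  have finite_G: "\<forall>u\<in>?P. finite (G (u j'))"
    using finite_subset[OF G(1)[OF value_in_R] assms(1)] by blast
  have "{t \<in> J \<rightarrow>\<^sub>E R. t j \<in> G (t j')} \<subseteq> (\<lambda>(u, y). u(j := y)) ` ?S"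
  proof
    fix t assume t: "t \<in> {t \<in> J \<rightarrow>\<^sub>E R. t j \<in> G (t j')}"
    have "t = (restrict t (J - {j}))(j := t j)"
      using t by (auto simp: fun_eq_iff PiE_iff extensional_def)
    moreover have "(restrict t (J - {j}), t j) \<in> ?S"
      using t assms by (auto simp: PiE_iff)
    ultimately show "t \<in> (\<lambda>(u, y). u(j := y)) ` ?S"
      by (intro image_eqI[where x = "(restrict t (J - {j}), t j)"]) simp_all
  qed
  then have "card {t \<in> J \<rightarrow>\<^sub>E R. t j \<in> G (t j')} \<le> card ?S"
    using finite_P finite_G by (intro surj_card_le finite_SigmaI) auto
  also have "card ?S = (\<Sum>u\<in>?P. card (G (u j')))"
    using finite_P finite_G by (rule card_SigmaI)
  finally have "real (card {t \<in> J \<rightarrow>\<^sub>E R. t j \<in> G (t j')}) \<le> (\<Sum>u\<in>?P. real (card (G (u j'))))"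
    by (simp flip: of_nat_sum)
  also have "\<dots> \<le> (\<Sum>u\<in>?P. g)"
    using G(2) value_in_R by (intro sum_mono) auto
  also have "\<dots> = g * real (card R) ^ (card J - 1)"
    using assms by (simp add: card_PiE)
  finally show ?thesis .
qed

locale dominated_family =
  fixes \<mu> :: "'a pmf" and \<nu> :: "'i \<Rightarrow> 'a pmf" and I :: "'i set" and K :: real
    and form :: "'f \<Rightarrow> 'a \<Rightarrow> 'd" and F :: "'f set" and D :: "'d set"
    and m :: nat and \<eta> M :: real
  assumes finite_I: "finite I" and finite_F: "finite F" and finite_D: "finite D"
    and dominated_\<nu>: "\<And>i. i \<in> I \<Longrightarrow> dominated K \<mu> (\<nu> i)"
    and form_values: "\<And>f. f \<in> F \<Longrightarrow> form f ` set_pmf \<mu> \<subseteq> D"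
    and m_pos: "0 < m" and \<eta>_pos: "0 < \<eta>" and M_pos: "0 < M"
    and few_biased: "\<And>i. i \<in> I \<Longrightarrow>
      real (card {f \<in> F. \<exists>d\<in>D. \<eta> < \<bar>pmf (map_pmf (form f) (\<nu> i)) d - 1 / real (card D)\<bar>}) \<le> M"
begin

definition law :: "'f \<Rightarrow> 'i \<Rightarrow> 'd pmf" where
  "law f i = map_pmf (form f) (\<nu> i)"

definition biased :: "'i \<Rightarrow> 'f set" where
  "biased i = {f \<in> F. \<exists>d\<in>D. \<eta> < \<bar>pmf (law f i) d - 1 / real (card D)\<bar>}"

definition good_tuple :: "(nat \<Rightarrow> 'i) \<Rightarrow> bool" where
  "good_tuple t \<longleftrightarrow>
    (\<forall>f\<in>F. - (3 * real (card D) * real m * \<eta>) \<le> cor D m (\<lambda>j. law f (t j)))"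

definition good_set :: "real \<Rightarrow> 'i set \<Rightarrow> bool" where
  "good_set \<epsilon> R \<longleftrightarrow>
     (1 - \<epsilon>) * real (card R) ^ m \<le> real (card {t \<in> {1..m} \<rightarrow>\<^sub>E R. good_tuple t})"

definition label :: "'f list \<Rightarrow> 'a \<Rightarrow> 'd list" where
  "label fs x = map (\<lambda>f. form f x) fs"

definition label_energy :: "'f list \<Rightarrow> 'i \<Rightarrow> real" where
  "label_energy fs i = energy (map_pmf (label fs) \<mu>) (map_pmf (label fs) (\<nu> i))"

definition predicted :: "'f list \<Rightarrow> 'f \<Rightarrow> 'i \<Rightarrow> 'd \<Rightarrow> real" where
  "predicted fs f i = predicted_prob \<mu> (\<nu> i) (label fs) (form f)"

definition gains :: "'f list \<Rightarrow> 'f \<Rightarrow> 'i \<Rightarrow> bool" where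
  "gains fs f i \<longleftrightarrow> label_energy fs i + \<eta>\<^sup>2 \<le> label_energy (f # fs) i"

definition consistent :: "'f list \<Rightarrow> 'i set \<Rightarrow> bool" where
  "consistent fs R \<longleftrightarrow>
    (\<forall>i\<in>R. \<forall>i'\<in>R. \<forall>f d. \<bar>predicted fs f i d - predicted fs f i' d\<bar> \<le> \<eta>)"

lemma set_pmf_law_subset:
  assumes "f \<in> F" "i \<in> I" shows "set_pmf (law f i) \<subseteq> D"
  using form_values[OF assms(1)] dominated_set_pmf_subset[OF dominated_\<nu>[OF assms(2)]]
  by (auto simp: law_def)

lemma label_energy_nonneg: "0 \<le> label_energy fs i"
  by (simp add: label_energy_def energy_nonneg)

lemma label_energy_le: "i \<in> I \<Longrightarrow> label_energy fs i \<le> K"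
  unfolding label_energy_def by (intro energy_le dominated_map_pmf dominated_\<nu>)

lemma gains_if_unpredicted:
  assumes "i \<in> I" and unpredicted: "\<eta> < \<bar>pmf (law f i) d - predicted fs f i d\<bar>"
  shows "gains fs f i"
proof -
  let ?P = "map_pmf (label (f # fs)) \<mu>" and ?Q = "map_pmf (label (f # fs)) (\<nu> i)"
  have "\<eta>\<^sup>2 \<le> (pmf (law f i) d - predicted fs f i d)\<^sup>2"
    using unpredicted \<eta>_pos by (metis abs_ge_zero less_eq_real_def power2_abs power_mono)
  also have "\<dots> = (pmf (map_pmf hd ?Q) d - predicted_prob ?P ?Q tl hd d)\<^sup>2"
    by (simp add: law_def predicted_def predicted_prob_map_pmf pmf.map_comp o_def
        label_def[abs_def])
  also have "\<dots> \<le> energy ?P ?Q - energy (map_pmf tl ?P) (map_pmf tl ?Q)"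
    by (rule energy_increment[OF dominated_map_pmf[OF dominated_\<nu>[OF assms(1)]]])
  also have "\<dots> = label_energy (f # fs) i - label_energy fs i"
    by (simp add: label_energy_def pmf.map_comp o_def label_def[abs_def])
  finally show ?thesis by (simp add: gains_def)
qed

lemma exists_consistent_subset:
  fixes w :: nat
  assumes "R \<subseteq> I" "set fs \<subseteq> F" "length fs \<le> k" "0 < card D"
    and "0 < w" and w: "real (card D ^ k) \<le> real w * \<eta>"
  shows "\<exists>R'\<subseteq>R. consistent fs R' \<and> card R \<le> (w + 1) ^ (card D ^ k) * card R'"
proof -
  let ?Z = "{ys. set ys \<subseteq> D \<and> length ys = length fs}"
  have finite_Z: "finite ?Z" by (rule finite_lists_length_eq[OF finite_D])
  have card_Z: "card ?Z \<le> card D ^ k"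
    using assms by (simp add: card_lists_length_eq[OF finite_D] power_increasing)
  have labels: "label fs ` set_pmf \<mu> \<subseteq> ?Z"
    using assms(2) form_values by (fastforce simp: label_def)
  obtain R' where R': "R' \<subseteq> R" "card R \<le> (w + 1) ^ card ?Z * card R'"
    "\<forall>i\<in>R'. \<forall>i'\<in>R'. \<forall>y\<in>?Z.
      \<bar>pmf (map_pmf (label fs) (\<nu> i)) y - pmf (map_pmf (label fs) (\<nu> i')) y\<bar> \<le> 1 / real w"
    using pigeonhole_close_functions[of R ?Z w "\<lambda>i. pmf (map_pmf (label fs) (\<nu> i))"]
      finite_subset[OF assms(1) finite_I] finite_Z \<open>0 < w\<close> by (auto simp: pmf_le_1)
  have "\<bar>predicted fs f i d - predicted fs f i' d\<bar> \<le> \<eta>" if "i \<in> R'" "i' \<in> R'" for f d i i'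
  proof -
    have "\<bar>predicted fs f i d - predicted fs f i' d\<bar>
        \<le> (\<Sum>y\<in>?Z. \<bar>pmf (map_pmf (label fs) (\<nu> i)) y - pmf (map_pmf (label fs) (\<nu> i')) y\<bar>)"
      unfolding predicted_def using that R'(1) assms(1)
      by (intro predicted_prob_diff_le[OF finite_Z labels dominated_\<nu> dominated_\<nu>]) auto
    also have "\<dots> \<le> (\<Sum>y\<in>?Z. 1 / real w)" using that R'(3) by (intro sum_mono) blast
    also have "\<dots> \<le> real (card D ^ k) / real w"
      using of_nat_mono[OF card_Z, where 'a = real] by (simp add: divide_right_mono)
    also have "\<dots> \<le> \<eta>" using w \<open>0 < w\<close> by (simp add: field_simps)
    finally show ?thesis .
  qed
  then have "consistent fs R'" by (simp add: consistent_def)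
  moreover have "card R \<le> (w + 1) ^ (card D ^ k) * card R'"
    using R'(2) card_Z by (meson le_add2 mult_le_mono1 order_trans power_increasing)
  ultimately show ?thesis using R'(1) by blast
qed

lemma cor_law_ge_if_as_predicted:
  assumes "f \<in> F" and R: "R \<subseteq> I" "consistent fs R" and t: "t \<in> {1..m} \<rightarrow>\<^sub>E R"
    and as_predicted: "\<And>j d. j \<in> {1..m} \<Longrightarrow>
      \<bar>pmf (law f (t j)) d - predicted fs f (t j) d\<bar> \<le> \<eta>"
  shows "- (real (card D) * real m * (3 * \<eta>)) \<le> cor D m (\<lambda>j. law f (t j))"
proof -
  have one: "1 \<in> {1..m}" using m_pos by auto
  have "\<bar>pmf (law f (t j)) d - pmf (law f (t 1)) d\<bar> \<le> 3 * \<eta>" if "j \<in> {1..m}" for j d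
  proof -
    have "\<bar>predicted fs f (t j) d - predicted fs f (t 1) d\<bar> \<le> \<eta>"
      using R(2) PiE_mem[OF t that] PiE_mem[OF t one] by (simp add: consistent_def)
    then show ?thesis using as_predicted[OF that, of d] as_predicted[OF one, of d] by linarith
  qed
  moreover have "set_pmf (law f (t 1)) \<subseteq> D"
    using \<open>f \<in> F\<close> R(1) PiE_mem[OF t one] by (intro set_pmf_law_subset) auto
  ultimately show ?thesis using finite_D by (intro cor_ge_if_close)
qed

lemma cor_law_ge_if_others_unbiased:
  assumes "f \<in> F" "j \<in> {1..m}" "t j \<in> I"
    and unbiased: "\<And>j'. j' \<in> {1..m} - {j} \<Longrightarrow> f \<notin> biased (t j')"
  shows "- (real (card D) * real m * \<eta>) \<le> cor D m (\<lambda>j. law f (t j))"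
proof (rule cor_ge_if_all_but_one_near_uniform[OF finite_D assms(2)])
  show "set_pmf (law f (t j)) \<subseteq> D" using assms(1,3) by (rule set_pmf_law_subset)
  show "\<bar>pmf (law f (t j')) d - 1 / real (card D)\<bar> \<le> \<eta>"
    if "j' \<in> {1..m} - {j}" "d \<in> D" for j' d
    using unbiased[OF that(1)] \<open>f \<in> F\<close> that(2) by (auto simp: biased_def not_less)
qed (use \<eta>_pos in simp)

lemma bad_tuple_witness:
  assumes R: "R \<subseteq> I" "consistent fs R" and t: "t \<in> {1..m} \<rightarrow>\<^sub>E R" "\<not> good_tuple t"
  shows "\<exists>j\<in>{1..m}. \<exists>j'\<in>{1..m} - {j}. \<exists>f\<in>biased (t j'). gains fs f (t j)"
proof -
  obtain f where f: "f \<in> F"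
    and bad: "cor D m (\<lambda>j. law f (t j)) < - (3 * real (card D) * real m * \<eta>)"
    using t(2) by (auto simp: good_tuple_def not_le)
  have t_in_I: "t j \<in> I" if "j \<in> {1..m}" for j using PiE_mem[OF t(1) that] R(1) by blast
  have "\<exists>j\<in>{1..m}. \<exists>d. \<eta> < \<bar>pmf (law f (t j)) d - predicted fs f (t j) d\<bar>"
  proof (rule ccontr)
    assume "\<not> ?thesis"
    then have "- (real (card D) * real m * (3 * \<eta>)) \<le> cor D m (\<lambda>j. law f (t j))"
      by (intro cor_law_ge_if_as_predicted[OF f R t(1)]) (auto simp: not_less)
    then show False using bad by simp
  qed
  then obtain j where j: "j \<in> {1..m}" and gain: "gains fs f (t j)"
    using gains_if_unpredicted t_in_I by blast
  have "0 \<le> real (card D) * real m * \<eta>" using \<eta>_pos by simp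
  then have "\<not> - (real (card D) * real m * \<eta>) \<le> cor D m (\<lambda>j. law f (t j))"
    using bad by linarith
  then obtain j' where "j' \<in> {1..m} - {j}" "f \<in> biased (t j')"
    using cor_law_ge_if_others_unbiased[where t = t, OF f j t_in_I[OF j]] by blast
  then show ?thesis using j gain by blast
qed

definition gainers :: "'f list \<Rightarrow> 'i set \<Rightarrow> 'i \<Rightarrow> 'i set" where
  "gainers fs R i' = {i \<in> R. \<exists>f\<in>biased i'. gains fs f i}"

lemma card_gainers_le:
  assumes "i' \<in> I" "0 \<le> X"
    and unpopular: "\<And>f. f \<in> F \<Longrightarrow> real (card {i \<in> R. gains fs f i}) \<le> X"
  shows "real (card (gainers fs R i')) \<le> M * X"
proof -
  have finite_biased: "finite (biased i')" using finite_F by (simp add: biased_def)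
  have "gainers fs R i' = (\<Union>f\<in>biased i'. {i \<in> R. gains fs f i})" by (auto simp: gainers_def)
  then have "card (gainers fs R i') \<le> (\<Sum>f\<in>biased i'. card {i \<in> R. gains fs f i})"
    using card_UN_le[OF finite_biased] by simp
  then have "real (card (gainers fs R i')) \<le> (\<Sum>f\<in>biased i'. real (card {i \<in> R. gains fs f i}))"
    by (simp flip: of_nat_sum)
  also have "\<dots> \<le> real (card (biased i')) * X"
    using unpopular by (intro sum_bounded_above) (auto simp: biased_def)
  also have "\<dots> \<le> M * X"
    using few_biased[OF assms(1)] \<open>0 \<le> X\<close>
    by (intro mult_right_mono) (auto simp: biased_def law_def)
  finally show ?thesis .
qed

lemma card_bad_tuples_le:
  assumes R: "R \<subseteq> I" "consistent fs R" and "0 \<le> X"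
    and unpopular: "\<And>f. f \<in> F \<Longrightarrow> real (card {i \<in> R. gains fs f i}) \<le> X"
  shows "real (card {t \<in> {1..m} \<rightarrow>\<^sub>E R. \<not> good_tuple t})
      \<le> (real m)\<^sup>2 * (M * X * real (card R) ^ (m - 1))"
proof -
  let ?J = "{1..m}"
  let ?P = "{(j, j') \<in> ?J \<times> ?J. j \<noteq> j'}"
  let ?E = "\<lambda>(j, j'). {t \<in> ?J \<rightarrow>\<^sub>E R. t j \<in> gainers fs R (t j')}"
  have finite_R: "finite R" using R(1) finite_I by (rule finite_subset)
  have finite_P: "finite ?P" by (rule finite_subset[of _ "?J \<times> ?J"]) auto
  have "card ?P \<le> card (?J \<times> ?J)" by (intro card_mono) auto
  then have card_P: "real (card ?P) \<le> (real m)\<^sup>2"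
    by (simp add: card_cartesian_product power2_eq_square flip: of_nat_mult)
  have "{t \<in> ?J \<rightarrow>\<^sub>E R. \<not> good_tuple t} \<subseteq> (\<Union>q\<in>?P. ?E q)"
  proof
    fix t assume "t \<in> {t \<in> ?J \<rightarrow>\<^sub>E R. \<not> good_tuple t}"
    then have t: "t \<in> ?J \<rightarrow>\<^sub>E R" "\<not> good_tuple t" by auto
    from bad_tuple_witness[OF R t]
    obtain j j' f where "j \<in> ?J" "j' \<in> ?J - {j}" "f \<in> biased (t j')" "gains fs f (t j)"
      by (elim bexE)
    then have "t \<in> ?E (j, j')" "(j, j') \<in> ?P" using t(1) by (auto simp: gainers_def)
    then show "t \<in> (\<Union>q\<in>?P. ?E q)" by blast
  qed
  then have "card {t \<in> ?J \<rightarrow>\<^sub>E R. \<not> good_tuple t} \<le> card (\<Union>q\<in>?P. ?E q)"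
    using finite_P finite_R by (intro card_mono finite_UN_I) (auto simp: finite_PiE)
  also have "\<dots> \<le> (\<Sum>q\<in>?P. card (?E q))" using finite_P by (rule card_UN_le)
  finally have "real (card {t \<in> ?J \<rightarrow>\<^sub>E R. \<not> good_tuple t}) \<le> (\<Sum>q\<in>?P. real (card (?E q)))"
    by (simp flip: of_nat_sum)
  also have "\<dots> \<le> real (card ?P) * (M * X * real (card R) ^ (m - 1))"
    using card_constrained_PiE_le[OF finite_R, of ?J _ _ "gainers fs R" "M * X"]
      card_gainers_le[OF _ \<open>0 \<le> X\<close> unpopular] R(1)
    by (intro sum_bounded_above) (auto simp: gainers_def)
  also have "\<dots> \<le> (real m)\<^sup>2 * (M * X * real (card R) ^ (m - 1))"
    using card_P M_pos \<open>0 \<le> X\<close> by (intro mult_right_mono) auto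
  finally show ?thesis .
qed

lemma good_setI:
  assumes "finite R" "real (card {t \<in> {1..m} \<rightarrow>\<^sub>E R. \<not> good_tuple t}) \<le> \<epsilon> * real (card R) ^ m"
  shows "good_set \<epsilon> R"
proof -
  let ?T = "{1..m} \<rightarrow>\<^sub>E R"
  have "card {t \<in> ?T. good_tuple t} + card {t \<in> ?T. \<not> good_tuple t}
      = card ({t \<in> ?T. good_tuple t} \<union> {t \<in> ?T. \<not> good_tuple t})"
    using assms(1) by (intro card_Un_disjoint[symmetric]) (auto simp: finite_PiE)
  also have "{t \<in> ?T. good_tuple t} \<union> {t \<in> ?T. \<not> good_tuple t} = ?T" by auto
  also have "card ?T = card R ^ m" by (simp add: card_PiE)
  finally have "real (card {t \<in> ?T. good_tuple t} + card {t \<in> ?T. \<not> good_tuple t})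
      = real (card R ^ m)"
    by (rule arg_cong)
  then show ?thesis using assms(2) by (simp add: good_set_def left_diff_distrib)
qed

lemma exists_popular_gain:
  assumes R: "R \<subseteq> I" "consistent fs R" and "0 < \<epsilon>" and bad: "\<not> good_set \<epsilon> R"
  shows "\<exists>f\<in>F. real (card R) \<le> (real m)\<^sup>2 * M / \<epsilon> * real (card {i \<in> R. gains fs f i})"
proof (rule ccontr)
  assume unpopular: "\<not> ?thesis"
  define X where "X = \<epsilon> * real (card R) / ((real m)\<^sup>2 * M)"
  have "real (card {i \<in> R. gains fs f i}) \<le> X" if "f \<in> F" for f
  proof -
    have "(real m)\<^sup>2 * M / \<epsilon> * real (card {i \<in> R. gains fs f i}) < real (card R)"
      using unpopular that by (meson not_le)
    then show ?thesis using \<open>0 < \<epsilon>\<close> M_pos m_pos by (simp add: X_def field_simps)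
  qed
  moreover have "0 \<le> X" using \<open>0 < \<epsilon>\<close> M_pos by (simp add: X_def)
  ultimately have "real (card {t \<in> {1..m} \<rightarrow>\<^sub>E R. \<not> good_tuple t})
      \<le> (real m)\<^sup>2 * (M * X * real (card R) ^ (m - 1))"
    by (intro card_bad_tuples_le[OF R])
  also have "\<dots> = \<epsilon> * (real (card R) * real (card R) ^ (m - 1))"
    using M_pos m_pos by (simp add: X_def)
  also have "real (card R) * real (card R) ^ (m - 1) = real (card R) ^ m"
    using m_pos by (simp flip: power_Suc)
  finally show False
    using bad good_setI finite_subset[OF R(1) finite_I] by blast
qed

text \<open>Making the laws of a label nearly agree costs the first factor, and choosing a popular form
  the second.\<close>

definition step_loss :: "nat \<Rightarrow> nat \<Rightarrow> real \<Rightarrow> real" where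
  "step_loss w k \<epsilon> = real (w + 1) ^ (card D ^ k) * (1 + (real m)\<^sup>2 * M / \<epsilon>)"

lemma good_subset_or_gain:
  assumes R: "R \<subseteq> I" and fs: "set fs \<subseteq> F" "length fs \<le> k"
    and "0 < card D" "0 < w" "real (card D ^ k) \<le> real w * \<eta>" "0 < \<epsilon>"
  obtains R' where "R' \<subseteq> R" "good_set \<epsilon> R'" "real (card R) \<le> step_loss w k \<epsilon> * real (card R')"
  | f R' where "f \<in> F" "R' \<subseteq> R" "\<And>i. i \<in> R' \<Longrightarrow> gains fs f i"
      "real (card R) \<le> step_loss w k \<epsilon> * real (card R')"
proof -
  let ?V = "real (w + 1) ^ (card D ^ k)" and ?q = "(real m)\<^sup>2 * M / \<epsilon>"
  have q: "0 \<le> ?q" using M_pos \<open>0 < \<epsilon>\<close> by simp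
  obtain S where S: "S \<subseteq> R" "consistent fs S" "card R \<le> (w + 1) ^ (card D ^ k) * card S"
    using exists_consistent_subset[OF R fs] assms(4-6) by blast
  have card_R: "real (card R) \<le> step_loss w k \<epsilon> * x" if "real (card S) \<le> (1 + ?q) * x" for x
  proof -
    have "real (card R) \<le> ?V * real (card S)"
      using of_nat_mono[OF S(3), where 'a = real] by simp
    also have "\<dots> \<le> ?V * ((1 + ?q) * x)"
      using that by (intro mult_left_mono) auto
    finally show ?thesis by (simp add: step_loss_def mult.assoc)
  qed
  show thesis
  proof (cases "good_set \<epsilon> S")
    case True
    have "real (card S) \<le> (1 + ?q) * real (card S)"
      using mult_nonneg_nonneg[OF q, of "real (card S)"] by (simp add: distrib_right)
    then show thesis using S(1) True card_R that(1) by blast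
  next
    case False
    then obtain f where f: "f \<in> F" "real (card S) \<le> ?q * real (card {i \<in> S. gains fs f i})"
      using exists_popular_gain[OF _ S(2) \<open>0 < \<epsilon>\<close>] S(1) R by blast
    have "real (card S) \<le> (1 + ?q) * real (card {i \<in> S. gains fs f i})"
      using f(2) by (simp add: distrib_right)
    then show thesis using S(1) f(1) card_R that(2)[of f "{i \<in> S. gains fs f i}"] by blast
  qed
qed

lemma step_loss_ge_1: "0 < \<epsilon> \<Longrightarrow> 1 \<le> step_loss w k \<epsilon>"
  unfolding step_loss_def using M_pos mult_mono[of 1 "real (w + 1) ^ (card D ^ k)" 1]
  by (simp add: one_le_power)

lemma energy_growth_if_no_good_subset:
  assumes "0 < card D" "0 < w" "real (card D ^ k) \<le> real w * \<eta>" "0 < \<epsilon>"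
    and no_good: "\<And>R. R \<subseteq> I \<Longrightarrow> good_set \<epsilon> R \<Longrightarrow>
      step_loss w k \<epsilon> ^ k * real (card R) < real (card I)"
    and "j \<le> k"
  shows "\<exists>R\<subseteq>I. \<exists>fs. set fs \<subseteq> F \<and> length fs = j
    \<and> real (card I) \<le> step_loss w k \<epsilon> ^ j * real (card R)
    \<and> (\<forall>i\<in>R. real j * \<eta>\<^sup>2 \<le> label_energy fs i)"
  using \<open>j \<le> k\<close>
proof (induction j)
  case 0
  show ?case
    by (intro exI[of _ I] conjI exI[of _ "[]"]) (auto simp: label_energy_nonneg)
next
  case (Suc j)
  let ?c = "step_loss w k \<epsilon>"
  have c: "1 \<le> ?c" using \<open>0 < \<epsilon>\<close> by (rule step_loss_ge_1)
  obtain R fs where R: "R \<subseteq> I" "real (card I) \<le> ?c ^ j * real (card R)"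
    and fs: "set fs \<subseteq> F" "length fs = j" "\<forall>i\<in>R. real j * \<eta>\<^sup>2 \<le> label_energy fs i"
    using Suc by fastforce
  have card_I: "real (card I) \<le> ?c ^ Suc j * real (card R')"
    if "real (card R) \<le> ?c * real (card R')" for R'
  proof -
    have "?c ^ j * real (card R) \<le> ?c ^ j * (?c * real (card R'))"
      using c that by (intro mult_left_mono) auto
    then show ?thesis using R(2) by (simp add: mult_ac)
  qed
  have "length fs \<le> k" using fs(2) Suc.prems by simp
  then show ?case
  proof (cases rule: good_subset_or_gain[OF R(1) fs(1) _ assms(1-4)])
    case (2 R')
    have "?c ^ Suc j * real (card R') \<le> ?c ^ k * real (card R')"
      using c Suc.prems by (intro mult_right_mono power_increasing) auto
    then show ?thesis using card_I[OF 2(3)] no_good[of R'] 2(1,2) R(1) by force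
  next
    case (3 f R')
    have "\<forall>i\<in>R'. real (Suc j) * \<eta>\<^sup>2 \<le> label_energy (f # fs) i"
      using 3(2,3) fs(3) by (fastforce simp: gains_def distrib_right)
    then show ?thesis
      using 3(1,2) R(1) fs(1,2) card_I[OF 3(4)]
      by (intro exI[of _ R'] conjI exI[of _ "f # fs"]) auto
  qed
qed

lemma exists_good_subset:
  assumes "I \<noteq> {}" "0 < card D" "0 < w" "real (card D ^ k) \<le> real w * \<eta>" "0 < \<epsilon>"
    and K: "K < real k * \<eta>\<^sup>2"
  shows "\<exists>R\<subseteq>I. good_set \<epsilon> R \<and> real (card I) \<le> step_loss w k \<epsilon> ^ k * real (card R)"
proof (rule ccontr)
  assume "\<not> ?thesis"
  then obtain R fs where R: "R \<subseteq> I" "real (card I) \<le> step_loss w k \<epsilon> ^ k * real (card R)"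
    "\<forall>i\<in>R. real k * \<eta>\<^sup>2 \<le> label_energy fs i"
    using energy_growth_if_no_good_subset[OF assms(2-5) _ order.refl] by (meson not_le)
  have "0 < card I" using \<open>I \<noteq> {}\<close> finite_I by (simp add: card_gt_0_iff)
  then have "R \<noteq> {}" using R(2) by auto
  then obtain i where "i \<in> R" by blast
  then show False using R(1,3) K label_energy_le[of i fs] by fastforce
qed

end

section \<open>Dense subsets of the cube\<close>

definition high_cor_tuples ::
    "nat \<Rightarrow> nat \<Rightarrow> nat \<Rightarrow> real \<Rightarrow> ('i \<Rightarrow> (nat \<Rightarrow> int) set) \<Rightarrow> 'i set \<Rightarrow> (nat \<Rightarrow> 'i) set" where
  "high_cor_tuples p n m \<nu> A R = {t \<in> {1..m} \<rightarrow>\<^sub>E R.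
     \<forall>\<phi>. mod_form p n \<phi> \<longrightarrow> cor_on (carrier (F_ring p)) m (\<lambda>j. A (t j)) \<phi> \<ge> - \<nu>}"

definition dense_family :: "nat \<Rightarrow> real \<Rightarrow> ('i \<Rightarrow> (nat \<Rightarrow> int) set) \<Rightarrow> 'i set \<Rightarrow> bool" where
  "dense_family n \<delta> A I \<longleftrightarrow> finite I \<and> I \<noteq> {} \<and>
     (\<forall>i\<in>I. A i \<noteq> {} \<and> A i \<subseteq> cube n \<and> cube_density n (A i) \<ge> \<delta>)"

definition has_high_cor_subset ::
    "nat \<Rightarrow> nat \<Rightarrow> nat \<Rightarrow> real \<Rightarrow> real \<Rightarrow> ('i \<Rightarrow> (nat \<Rightarrow> int) set) \<Rightarrow> 'i set \<Rightarrow> real \<Rightarrow> bool" where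
  "has_high_cor_subset p n m \<nu> \<epsilon> A I B \<longleftrightarrow> (\<exists>R\<subseteq>I. real (card I) \<le> B * real (card R) \<and>
     (1 - \<epsilon>) * real (card R) ^ m \<le> real (card (high_cor_tuples p n m \<nu> A R)))"

lemma has_high_cor_subset_mono:
  assumes "has_high_cor_subset p n m \<nu> \<epsilon> A I B" "B \<le> B'"
  shows "has_high_cor_subset p n m \<nu> \<epsilon> A I B'"
proof -
  obtain R where R: "R \<subseteq> I" "real (card I) \<le> B * real (card R)"
    "(1 - \<epsilon>) * real (card R) ^ m \<le> real (card (high_cor_tuples p n m \<nu> A R))"
    using assms(1) unfolding has_high_cor_subset_def by blast
  have "B * real (card R) \<le> B' * real (card R)" using assms(2) by (rule mult_right_mono) simp
  then show ?thesis
    using R unfolding has_high_cor_subset_def by (intro exI[of _ R]) auto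
qed

lemma mod_form_eq_lform:
  assumes "prime p" "mod_form p n \<phi>"
  shows "\<exists>a\<in>F_space p n. \<forall>x\<in>F_space p n. \<phi> x = lform n a x mod int p"
proof -
  interpret residues "int p" "F_ring p"
    using assms(1) prime_gt_1_nat by unfold_locales auto
  obtain a where a: "a \<in> {1..n} \<rightarrow> carrier (F_ring p)"
    and \<phi>: "\<And>x. x \<in> F_space p n \<Longrightarrow> \<phi> x = (\<Oplus>\<^bsub>F_ring p\<^esub>i\<in>{1..n}. a i \<otimes>\<^bsub>F_ring p\<^esub> x i)"
    using assms(2) unfolding mod_form_def by blast
  have "\<phi> x = lform n (restrict a {1..n}) x mod int p" if "x \<in> F_space p n" for x
    using \<phi>[OF that] by (simp add: res_mult_eq sum_cong lform_def)
  moreover have "restrict a {1..n} \<in> F_space p n"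
    using a by (auto simp: F_space_def)
  ultimately show ?thesis by blast
qed

lemma cor_on_mod_form:
  assumes "prime p" "mod_form p n \<phi>" "\<And>j. j \<in> {1..m} \<Longrightarrow> B j \<noteq> {} \<and> B j \<subseteq> cube n"
  shows "\<exists>a\<in>F_space p n. cor_on (carrier (F_ring p)) m B \<phi>
    = cor {0..int p - 1} m (\<lambda>j. map_pmf (\<lambda>x. lform n a x mod int p) (pmf_of_set (B j)))"
proof -
  obtain a where a: "a \<in> F_space p n" "\<forall>x\<in>F_space p n. \<phi> x = lform n a x mod int p"
    using mod_form_eq_lform[OF assms(1,2)] by blast
  have "map_pmf \<phi> (pmf_of_set (B j)) = map_pmf (\<lambda>x. lform n a x mod int p) (pmf_of_set (B j))"
    if "j \<in> {1..m}" for j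
  proof (intro map_pmf_cong refl)
    fix x assume "x \<in> set_pmf (pmf_of_set (B j))"
    moreover have "finite (B j)"
      using assms(3)[OF that] by (auto intro: finite_subset[OF _ finite_cube])
    ultimately have "x \<in> cube n"
      using assms(3)[OF that] by auto
    then show "\<phi> x = lform n a x mod int p"
      using a(2) cube_subset_F_space[OF assms(1)] by blast
  qed
  then show ?thesis
    using a(1) by (intro bexI[of _ a]) (simp_all add: cor_on_def cor_def residue_ring_def)
qed

lemma has_high_cor_subset_if_few_biased_forms:
  fixes A :: "'i \<Rightarrow> (nat \<Rightarrow> int) set"
  assumes p: "prime p" and pos: "0 < m" "0 < \<delta>" "0 < \<epsilon>" "0 < \<eta>" "0 < M" "0 < w"
    and A: "dense_family n \<delta> A I"
    and few_biased: "\<And>Q. dominated (1 / \<delta>) (pmf_of_set (cube n)) Q \<Longrightarrow>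
      real (card (biased_forms p n \<eta> Q)) \<le> M"
    and k: "1 / \<delta> < real k * \<eta>\<^sup>2" and w: "real (p ^ k) \<le> real w * \<eta>"
  shows "has_high_cor_subset p n m (3 * real p * real m * \<eta>) \<epsilon> A I
    ((real (w + 1) ^ (p ^ k) * (1 + (real m)\<^sup>2 * M / \<epsilon>)) ^ k)"
proof -
  have p_pos: "0 < p" using p prime_gt_0_nat by simp
  have I: "finite I" "I \<noteq> {}" using A by (simp_all add: dense_family_def)
  have dominated: "dominated (1 / \<delta>) (pmf_of_set (cube n)) (pmf_of_set (A i))" if "i \<in> I" for i
    using A that \<open>0 < \<delta>\<close> by (intro dominated_pmf_of_set)
      (auto simp: dense_family_def cube_density_def card_cube field_simps)
  interpret dominated_family "pmf_of_set (cube n)" "\<lambda>i. pmf_of_set (A i)" I "1 / \<delta>"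
    "\<lambda>a x. lform n a x mod int p" "F_space p n" "{0..int p - 1}" m \<eta> M
  proof
    show "real (card {a \<in> F_space p n. \<exists>d\<in>{0..int p - 1}.
        \<eta> < \<bar>pmf (map_pmf (\<lambda>x. lform n a x mod int p) (pmf_of_set (A i))) d
          - 1 / real (card {0..int p - 1})\<bar>}) \<le> M" if "i \<in> I" for i
      using few_biased[OF dominated[OF that]] by (simp add: biased_forms_def)
  qed (use I(1) pos p_pos dominated in auto)
  have high_cor: "- (3 * real p * real m * \<eta>) \<le> cor_on (carrier (F_ring p)) m (\<lambda>j. A (t j)) \<phi>"
    if t: "t \<in> {1..m} \<rightarrow>\<^sub>E R" "R \<subseteq> I" "good_tuple t" and \<phi>: "mod_form p n \<phi>" for t R \<phi>
  proof -
    have "A (t j) \<noteq> {} \<and> A (t j) \<subseteq> cube n" if "j \<in> {1..m}" for j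
      using A t(2) PiE_mem[OF t(1) that] unfolding dense_family_def by blast
    from cor_on_mod_form[OF p \<phi>, of m "\<lambda>j. A (t j)", OF this]
    show ?thesis using t(3) by (auto simp: good_tuple_def law_def)
  qed
  obtain R where R: "R \<subseteq> I" "good_set \<epsilon> R" "real (card I) \<le> step_loss w k \<epsilon> ^ k * real (card R)"
    using exists_good_subset[of w k \<epsilon>] I(2) pos k w p_pos by auto
  have "{t \<in> {1..m} \<rightarrow>\<^sub>E R. good_tuple t} \<subseteq> high_cor_tuples p n m (3 * real p * real m * \<eta>) A R"
    using high_cor R(1) by (auto simp: high_cor_tuples_def)
  then have "card {t \<in> {1..m} \<rightarrow>\<^sub>E R. good_tuple t}
      \<le> card (high_cor_tuples p n m (3 * real p * real m * \<eta>) A R)"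
    using finite_subset[OF R(1) I(1)]
    by (intro card_mono) (auto simp: high_cor_tuples_def finite_PiE)
  then show ?thesis
    using R unfolding has_high_cor_subset_def
    by (intro exI[of _ R]) (auto simp: good_set_def step_loss_def)
qed

lemma power_mult_one_plus_le:
  fixes v q N :: real
  assumes "0 \<le> v" "0 \<le> q" "1 \<le> N"
  shows "(v * (1 + q * N)) ^ k \<le> (v * (1 + q)) ^ k * N ^ k"
proof -
  have "1 + q * N \<le> (1 + q) * N" using assms(3) by (simp add: distrib_right)
  then have "(v * (1 + q * N)) ^ k \<le> (v * ((1 + q) * N)) ^ k"
    using assms by (intro power_mono mult_left_mono) auto
  then show ?thesis by (simp add: power_mult_distrib mult.assoc)
qed

lemma has_high_cor_subset_polynomial:
  assumes p: "prime p" and pos: "0 < m" "0 < \<delta>" "0 < \<nu>" "0 < \<epsilon>"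
  shows "\<exists>B L. \<forall>n A (I :: 'i set). dense_family n \<delta> A I \<longrightarrow>
    has_high_cor_subset p n m \<nu> \<epsilon> A I (B * (real n + 1) ^ L)"
proof -
  define \<eta> where "\<eta> = \<nu> / (3 * real p * real m)"
  have \<eta>: "0 < \<eta>" "3 * real p * real m * \<eta> = \<nu>"
    using pos prime_gt_0_nat[OF p] by (simp_all add: \<eta>_def)
  obtain M L where "0 < M" and few_biased: "\<And>n Q. dominated (1 / \<delta>) (pmf_of_set (cube n)) Q \<Longrightarrow>
      real (card (biased_forms p n \<eta> Q)) \<le> M * (real n + 1) ^ L"
    using card_biased_forms_polynomial_bound[OF p _ \<eta>(1), of "1 / \<delta>"] pos by auto
  obtain k :: nat where "1 / \<delta> / \<eta>\<^sup>2 < real k" using reals_Archimedean2 by blast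
  then have k: "1 / \<delta> < real k * \<eta>\<^sup>2" using \<eta>(1) \<open>0 < \<delta>\<close> by (simp add: field_simps)
  obtain w :: nat where "real (p ^ k) / \<eta> < real w" using reals_Archimedean2 by blast
  moreover from this have w: "real (p ^ k) \<le> real w * \<eta>"
    using \<eta>(1) by (simp add: field_simps)
  moreover have "0 \<le> real (p ^ k) / \<eta>" using \<eta>(1) by simp
  ultimately have "0 < w" by linarith
  define v where "v = real (w + 1) ^ (p ^ k)"
  define q where "q = (real m)\<^sup>2 * M / \<epsilon>"
  have "has_high_cor_subset p n m \<nu> \<epsilon> A I ((v * (1 + q)) ^ k * (real n + 1) ^ (L * k))"
    if "dense_family n \<delta> A I" for n A and I :: "'i set"
  proof (rule has_high_cor_subset_mono)
    show "has_high_cor_subset p n m \<nu> \<epsilon> A I ((v * (1 + q * (real n + 1) ^ L)) ^ k)"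
      using has_high_cor_subset_if_few_biased_forms[OF p pos(1,2,4) \<eta>(1) _ \<open>0 < w\<close> that
          few_biased k w] \<open>0 < M\<close>
      by (simp add: \<eta>(2) v_def q_def mult.assoc[of "(real m)\<^sup>2"])
    show "(v * (1 + q * (real n + 1) ^ L)) ^ k \<le> (v * (1 + q)) ^ k * (real n + 1) ^ (L * k)"
      using power_mult_one_plus_le[of v q "(real n + 1) ^ L" k] \<open>0 < M\<close> \<open>0 < \<epsilon>\<close>
      by (simp add: v_def q_def one_le_power power_mult)
  qed
  then show ?thesis by blast
qed

lemma high_cor_tuples_dimension_0:
  assumes "prime p" "0 \<le> \<nu>" "\<forall>i\<in>R. A i \<noteq> {} \<and> A i \<subseteq> cube 0"
  shows "high_cor_tuples p 0 m \<nu> A R = {1..m} \<rightarrow>\<^sub>E R"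
proof -
  have A: "A i = cube 0" if "i \<in> R" for i
    using assms(3) that by (auto simp: cube_def)
  have "- \<nu> \<le> cor_on (carrier (F_ring p)) m (\<lambda>j. A (t j)) \<phi>"
    if t: "t \<in> {1..m} \<rightarrow>\<^sub>E R" and \<phi>: "mod_form p 0 \<phi>" for t \<phi>
  proof -
    have At: "A (t j) = cube 0" if "j \<in> {1..m}" for j
      using A PiE_mem[OF t that] .
    then obtain a where "cor_on (carrier (F_ring p)) m (\<lambda>j. A (t j)) \<phi> = cor {0..int p - 1} m
        (\<lambda>j. map_pmf (\<lambda>x. lform 0 a x mod int p) (pmf_of_set (A (t j))))"
      using cor_on_mod_form[OF assms(1) \<phi>, of m "\<lambda>j. A (t j)"] by auto
    also have "\<dots> = cor {0..int p - 1} m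
        (\<lambda>_. map_pmf (\<lambda>x. lform 0 a x mod int p) (pmf_of_set (cube 0)))"
      using At by (simp add: cor_def)
    also have "\<dots> \<ge> 0"
      using prime_gt_0_nat[OF assms(1)] by (intro cor_const_nonneg) auto
    finally show ?thesis using assms(2) by linarith
  qed
  then show ?thesis by (auto simp: high_cor_tuples_def)
qed

lemma polynomial_bound_absorb_constant:
  fixes B :: real
  shows "\<exists>C>0. \<forall>n\<ge>1. B * (real n + 1) ^ L \<le> (real n + 1) powr C"
proof -
  obtain N where N: "B < 2 ^ N" using real_arch_pow[of 2 B] by auto
  have "B * (real n + 1) ^ L \<le> (real n + 1) powr real (Suc (N + L))" if "n \<ge> 1" for n
  proof -
    have "B \<le> (real n + 1) ^ N"
      using N power_mono[of 2 "real n + 1" N] that by simp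
    then have "B * (real n + 1) ^ L \<le> (real n + 1) ^ N * (real n + 1) ^ L"
      by (rule mult_right_mono) simp
    also have "\<dots> \<le> (real n + 1) ^ Suc (N + L)"
      unfolding power_add[symmetric] by (intro power_increasing) auto
    finally show ?thesis by (subst powr_realpow) auto
  qed
  then show ?thesis by (intro exI[of _ "real (Suc (N + L))"]) auto
qed

lemma has_high_cor_subset_dimension_0:
  assumes "prime p" "0 \<le> \<nu>" "0 \<le> \<epsilon>" "dense_family 0 \<delta> A I"
  shows "has_high_cor_subset p 0 m \<nu> \<epsilon> A I 1"
proof -
  have "high_cor_tuples p 0 m \<nu> A I = {1..m} \<rightarrow>\<^sub>E I"
    using assms by (intro high_cor_tuples_dimension_0) (simp_all add: dense_family_def)
  then show ?thesis
    using assms(3) unfolding has_high_cor_subset_def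
    by (intro exI[of _ I]) (simp add: card_PiE algebra_simps)
qed

lemma has_high_cor_subset_powr:
  assumes "prime p" "0 < m" "0 < \<delta>" "0 < \<nu>" "0 < \<epsilon>"
  shows "\<exists>C>0. \<forall>n A (I :: 'i set). dense_family n \<delta> A I \<longrightarrow>
    has_high_cor_subset p n m \<nu> \<epsilon> A I ((real n + 1) powr C)"
proof -
  from has_high_cor_subset_polynomial[OF assms]
  obtain B L where polynomial: "\<forall>n A (I :: 'i set). dense_family n \<delta> A I \<longrightarrow>
      has_high_cor_subset p n m \<nu> \<epsilon> A I (B * (real n + 1) ^ L)"
    by (elim exE)
  obtain C where "0 < C" and C: "\<forall>n\<ge>1. B * (real n + 1) ^ L \<le> (real n + 1) powr C"
    using polynomial_bound_absorb_constant[of B L] by (elim exE conjE)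
  have "has_high_cor_subset p n m \<nu> \<epsilon> A I ((real n + 1) powr C)"
    if dense: "dense_family n \<delta> A I" for n A and I :: "'i set"
  proof (cases "n = 0") \<comment> \<open>then \<open>(n + 1) powr C = 1\<close> cannot absorb a constant\<close>
    case True
    then show ?thesis
      using has_high_cor_subset_dimension_0[of p \<nu> \<epsilon> \<delta> A I m] dense assms by simp
  next
    case False
    then show ?thesis
      using polynomial[rule_format, OF dense] C by (auto intro: has_high_cor_subset_mono)
  qed
  then show ?thesis using \<open>0 < C\<close> by blast
qed

theorem mainTheorem1:
  fixes p m :: nat and \<delta> \<nu> \<epsilon> :: real
  assumes "prime p" and "m \<ge> 2" and "\<delta> > 0" and "\<nu> > 0" and "\<epsilon> > 0"
  shows "\<exists>C::real. C > 0 \<and>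
    (\<forall>(n::nat) (s::nat) (A :: nat \<Rightarrow> (nat \<Rightarrow> int) set).
      s > 0 \<longrightarrow>
      (\<forall>i\<in>{1..s}. A i \<noteq> {} \<and> A i \<subseteq> cube n \<and> cube_density n (A i) \<ge> \<delta>) \<longrightarrow>
      (\<exists>R \<subseteq> {1..s}.
        real (card R) \<ge> real s / (real n + 1) powr C \<and>
        real (card {t \<in> {1..m} \<rightarrow>\<^sub>E R.
            \<forall>\<phi>. mod_form p n \<phi> \<longrightarrow> cor_on (carrier (F_ring p)) m (\<lambda>j. A (t j)) \<phi> \<ge> - \<nu>})
          \<ge> (1 - \<epsilon>) * real (card R) ^ m))"
proof -
  have "0 < m" using assms(2) by simp
  from has_high_cor_subset_powr[OF assms(1) this assms(3-5)]
  obtain C where "0 < C" and C: "\<forall>n A (I :: nat set). dense_family n \<delta> A I \<longrightarrow>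
      has_high_cor_subset p n m \<nu> \<epsilon> A I ((real n + 1) powr C)"
    by (elim exE conjE)
  show ?thesis
    unfolding high_cor_tuples_def[symmetric]
  proof (intro exI[of _ C] conjI allI impI \<open>0 < C\<close>)
    fix n s and A :: "nat \<Rightarrow> (nat \<Rightarrow> int) set"
    assume "0 < s" "\<forall>i\<in>{1..s}. A i \<noteq> {} \<and> A i \<subseteq> cube n \<and> cube_density n (A i) \<ge> \<delta>"
    then have "dense_family n \<delta> A {1..s}" by (auto simp: dense_family_def)
    then have "has_high_cor_subset p n m \<nu> \<epsilon> A {1..s} ((real n + 1) powr C)"
      using C by simp
    then obtain R where "R \<subseteq> {1..s}" "real s \<le> (real n + 1) powr C * real (card R)"
        "(1 - \<epsilon>) * real (card R) ^ m \<le> real (card (high_cor_tuples p n m \<nu> A R))"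
      by (auto simp: has_high_cor_subset_def)
    then show "\<exists>R\<subseteq>{1..s}. real (card R) \<ge> real s / (real n + 1) powr C
        \<and> real (card (high_cor_tuples p n m \<nu> A R)) \<ge> (1 - \<epsilon>) * real (card R) ^ m"
      by (intro exI[of _ R]) (simp add: divide_le_eq mult.commute)
  qed
qed

end
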